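(* Let $(q_n)$ be a sequence of positive integers with $q_n\to\infty$ and $q_n=n^{o(1)}$ (i.e. $\log q_n/\log n\to 0$). Let $G_n$, $n\ge 1$, be independent random graphs, $G_n$ uniformly distributed on $G(n,q_n+1)$. Then, almost surely, the normalized spectral measures $\mu_n=\mu(G_n)$ satisfy $W_p(\mu_n,\mu_\infty)\to 0$ as $n\to\infty$ for every $p\in[1,\infty)$, where $\mu_\infty$ is the semicircle distribution.
   Context: $G(n,q+1)$ denotes the set of all $(q+1)$-regular simple graphs on $n$ vertices (the random graph $G_n$ is taken uniform on this set, for those $n$ where it is nonempty). For a finite $(q+1)$-regular graph $H$ with $m$ vertices and adjacency eigenvalues $\lambda_1,\dots,\lambda_m$, the normalized spectral measure is $\mu(H)=\frac1m\sum_k\delta_{q^{-1/2}\lambda_k}$ (here $q=q_n$). Semicircle distribution: $d\mu_\infty(x)=\frac{1}{2\pi}\sqrt{4-x^2}\mathbf 1_{|x|\le 2}dx$. For probability measures $\mu,\nu$ on $\mathbb{R}$ with finite $p$-th moments, $W_p(\mu,\nu)=\inf_{\gamma}\big(\int|x-y|^pd\gamma(x,y)\big)^{1/p}$, the infimum over all couplings $\gamma$ of $\mu$ and $\nu$. *)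

theory Defs
  imports "HOL-Probability.Probability" "Jordan_Normal_Form.Char_Poly"
begin

definition simple_graph_on :: "nat \<Rightarrow> (nat \<times> nat) set \<Rightarrow> bool" where
  "simple_graph_on n E \<longleftrightarrow> E \<subseteq> {0..<n} \<times> {0..<n} \<and> (\<forall>i. (i, i) \<notin> E)
     \<and> (\<forall>i j. (i, j) \<in> E \<longrightarrow> (j, i) \<in> E)"

definition reg_graphs :: "nat \<Rightarrow> nat \<Rightarrow> (nat \<times> nat) set set" where
  "reg_graphs n d = {E. simple_graph_on n E \<and> (\<forall>i<n. card {j. (i, j) \<in> E} = d)}"

definition adj_matrix :: "nat \<Rightarrow> (nat \<times> nat) set \<Rightarrow> real mat" where
  "adj_matrix n E = mat n n (\<lambda>(i, j). if (i, j) \<in> E then 1 else 0)"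

definition adj_eigenvalues :: "nat \<Rightarrow> (nat \<times> nat) set \<Rightarrow> real multiset" where
  "adj_eigenvalues n E = proots (char_poly (adj_matrix n E))"

(* normalized spectral measure (1/n) sum_k delta_{q^{-1/2} lambda_k}, as a Borel measure *)
definition spectral_measure :: "nat \<Rightarrow> nat \<Rightarrow> (nat \<times> nat) set \<Rightarrow> real measure" where
  "spectral_measure q n E =
     distr (measure_pmf (pmf_of_multiset (image_mset (\<lambda>l. l / sqrt (real q)) (adj_eigenvalues n E))))
       borel (\<lambda>x. x)"

definition semicircle :: "real measure" where
  "semicircle = density lborel (\<lambda>x. ennreal (indicator {-2..2} x * sqrt (4 - x\<^sup>2) / (2 * pi)))"

definition couplings :: "real measure \<Rightarrow> real measure \<Rightarrow> (real \<times> real) measure set" where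
  "couplings \<mu> \<nu> = {\<gamma>. prob_space \<gamma> \<and> sets \<gamma> = sets (borel :: (real \<times> real) measure)
      \<and> distr \<gamma> borel fst = \<mu> \<and> distr \<gamma> borel snd = \<nu>}"

(* p-Wasserstein distance (for measures with finite p-th moments) *)
definition wasserstein :: "real \<Rightarrow> real measure \<Rightarrow> real measure \<Rightarrow> real" where
  "wasserstein p \<mu> \<nu> =
     enn2real (INF \<gamma>\<in>couplings \<mu> \<nu>. \<integral>\<^sup>+ z. ennreal (\<bar>fst z - snd z\<bar> powr p) \<partial>\<gamma>) powr (1 / p)"

end

theory Submission
  imports Defs "Jordan_Normal_Form.Schur_Decomposition" "HOL-Real_Asymp.Real_Asymp"
begin

text \<open>
  Let \<open>d = q + 1\<close> and let \<open>U\<^sub>r\<close> be the Chebyshev polynomials orthonormal for the semicircle law. The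
  number of closed nonbacktracking walks of length \<open>r\<close> in a \<open>d\<close>-regular graph is the trace of a
  polynomial in the adjacency matrix which, rescaled by \<open>q\<^sup>-\<^sup>r\<^sup>/\<^sup>2\<close>, is \<open>U\<^sub>r - U\<^sub>r\<^sub>-\<^sub>2 / q\<close>.
  So if there are only \<open>o(n)\<close> such walks, the integrals of \<open>U\<^sub>r\<close> (\<open>r \<ge> 1\<close>) against the spectral measures
  tend to \<open>0\<close>, hence all moments converge to those of the semicircle law; as the limit has
  compact support this gives weak convergence (via characteristic functions) and, by Skorohod coupling
  and boundedness of the moments, convergence in every \<open>W\<^sub>p\<close>.

  A closed nonbacktracking walk contains a cycle, so there are at most \<open>r d\<^sup>r\<close> times as many of them
  as there are cycles of length at most \<open>r\<close>. An edge switching argument shows that a fixed set of \<open>m\<close>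
  edges lies in the random graph with probability at most \<open>(2d/n)\<^sup>m\<close>; counting pairs of cycles, disjoint
  or not, bounds the second moment of the number of \<open>l\<close>-cycles by a power of \<open>d\<close>, that is, by \<open>n\<^sup>o\<^sup>(\<^sup>1\<^sup>)\<close>.
  Hence there are more than \<open>n\<^sup>3\<^sup>/\<^sup>4\<close> of them with probability \<open>O(n\<^sup>-\<^sup>5\<^sup>/\<^sup>4)\<close>, and Borel-Cantelli applies.
\<close>

section \<open>Switching in random regular graphs\<close>

lemma finite_reg_graphs: "finite (reg_graphs n d)"
  by (rule finite_subset[of _ "Pow ({0..<n} \<times> {0..<n})"])
    (auto simp: reg_graphs_def simple_graph_on_def)

lemma reg_graphsD:
  assumes "E \<in> reg_graphs n d"
  shows "E \<subseteq> {0..<n} \<times> {0..<n}" "finite E" "(i, i) \<notin> E" "(i, j) \<in> E \<Longrightarrow> (j, i) \<in> E"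
    "(i, j) \<in> E \<Longrightarrow> i < n" "(i, j) \<in> E \<Longrightarrow> j < n"
    "finite {j. (i, j) \<in> E}" "i < n \<Longrightarrow> card {j. (i, j) \<in> E} = d"
    "card {j. (i, j) \<in> E} \<le> d"
proof -
  show sub: "E \<subseteq> {0..<n} \<times> {0..<n}" and "(i, i) \<notin> E" and "(i, j) \<in> E \<Longrightarrow> (j, i) \<in> E"
    and deg: "i < n \<Longrightarrow> card {j. (i, j) \<in> E} = d"
    using assms by (auto simp: reg_graphs_def simple_graph_on_def)
  show "finite E" by (rule finite_subset[OF sub]) auto
  show "(i, j) \<in> E \<Longrightarrow> i < n" "(i, j) \<in> E \<Longrightarrow> j < n" using sub by auto
  show "finite {j. (i, j) \<in> E}" by (rule finite_subset[of _ "{0..<n}"]) (use sub in auto)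
  show "card {j. (i, j) \<in> E} \<le> d"
  proof (cases "i < n")
    case False
    then have "{j. (i, j) \<in> E} = {}" using sub by auto
    then show ?thesis by simp
  qed (simp add: deg)
qed

lemma card_reg_graph:
  assumes "E \<in> reg_graphs n d"
  shows "card E = n * d"
proof -
  have "E = Sigma {0..<n} (\<lambda>i. {j. (i, j) \<in> E})" using reg_graphsD(1)[OF assms] by auto
  also have "card \<dots> = n * d" using reg_graphsD[OF assms] by simp
  finally show ?thesis .
qed

text \<open>Both orientations of an undirected edge move together. Exchanging the middle arguments
  \<open>v\<close> and \<open>x\<close> describes the reverse move.\<close>

definition switch :: "nat \<Rightarrow> nat \<Rightarrow> nat \<Rightarrow> nat \<Rightarrow> (nat \<times> nat) set \<Rightarrow> (nat \<times> nat) set" where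
  "switch u v x y E = (E - {(u, v), (v, u), (x, y), (y, x)}) \<union> {(u, x), (x, u), (v, y), (y, v)}"

text \<open>Each of the four vertices loses one neighbour and gains another, so all degrees
  persist.\<close>

lemma switch_reg_graphs:
  assumes E: "E \<in> reg_graphs n d" and uv: "(u, v) \<in> E" and xy: "(x, y) \<in> E"
    and ne: "x \<noteq> u" "y \<noteq> v" and new: "(u, x) \<notin> E" "(v, y) \<notin> E"
  shows "switch u v x y E \<in> reg_graphs n d" and "switch u x v y (switch u v x y E) = E"
proof -
  note D = reg_graphsD[OF E]
  have sy: "(v, u) \<in> E" "(y, x) \<in> E" "(x, u) \<notin> E" "(y, v) \<notin> E" using uv xy new D(4) by blast+
  \<comment> \<open>\<open>x \<noteq> v\<close> since \<open>(u, v)\<close> is an edge and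
    \<open>(u, x)\<close> is not; \<open>y \<noteq> u\<close> likewise. With \<open>ne\<close>, all
    four vertices differ.\<close>
  have dist: "u \<noteq> v" "x \<noteq> y" "x \<noteq> v" "y \<noteq> u" using uv xy new sy D(3) by auto
  have lt: "u < n" "v < n" "x < n" "y < n" using D(5,6) uv xy by blast+
  show "switch u x v y (switch u v x y E) = E"
    unfolding switch_def using uv xy new sy dist ne by auto
  have swap: "card (insert b (A - {a})) = d" if "card A = d" "finite A" "a \<in> A" "b \<notin> A" for A and a b :: nat
    using that card_Suc_Diff1[of A a] by simp
  have "card {j. (i, j) \<in> switch u v x y E} = d" if i: "i < n" for i
  proof -
    let ?N = "\<lambda>i. {j. (i, j) \<in> E}"
    have c: "card (?N i) = d" "finite (?N i)" using D(7,8) i by auto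
    consider "i = u" | "i = v" | "i = x" | "i = y" | "i \<notin> {u, v, x, y}" by auto
    then show ?thesis
    proof cases
      case 1
      then have "{j. (i, j) \<in> switch u v x y E} = insert x (?N i - {v})"
        using dist ne by (auto simp: switch_def)
      then show ?thesis using swap[OF c] 1 uv new by simp
    next
      case 2
      then have "{j. (i, j) \<in> switch u v x y E} = insert y (?N i - {u})"
        using dist ne by (auto simp: switch_def)
      then show ?thesis using swap[OF c] 2 sy new by simp
    next
      case 3
      then have "{j. (i, j) \<in> switch u v x y E} = insert u (?N i - {y})"
        using dist ne by (auto simp: switch_def)
      then show ?thesis using swap[OF c] 3 sy xy by simp
    next
      case 4
      then have "{j. (i, j) \<in> switch u v x y E} = insert v (?N i - {x})"
        using dist ne by (auto simp: switch_def)
      then show ?thesis using swap[OF c] 4 sy xy by simp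
    next
      case 5
      then have "{j. (i, j) \<in> switch u v x y E} = ?N i" by (auto simp: switch_def)
      then show ?thesis using c by simp
    qed
  qed
  moreover have "simple_graph_on n (switch u v x y E)"
    unfolding simple_graph_on_def
  proof (intro conjI allI impI)
    show "switch u v x y E \<subseteq> {0..<n} \<times> {0..<n}" using D(1) lt by (auto simp: switch_def)
    show "(i, i) \<notin> switch u v x y E" for i using D(3) dist ne by (auto simp: switch_def)
    show "(j, i) \<in> switch u v x y E" if "(i, j) \<in> switch u v x y E" for i j
      using that D(4)[of i j] by (auto simp: switch_def)
  qed
  ultimately show "switch u v x y E \<in> reg_graphs n d" by (simp add: reg_graphs_def)
qed

text \<open>Of the \<open>n * d\<close> ordered edges, at most \<open>card F\<close> lie in
  \<open>F\<close>, at most \<open>(d + 1) * d\<close> start in the closed neighbourhood of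
  \<open>u\<close>, and at most as many end in that of \<open>v\<close>. The bound on
  \<open>n\<close> keeps this loss at no more than half.\<close>

lemma card_switchable_edges:
  assumes E: "E \<in> reg_graphs n d" and d: "d > 0" and F: "finite F"
    and n: "n \<ge> 4 * (d + 1) + 2 * card F"
  shows "n * d \<le> 2 * card {(x, y). (x, y) \<in> E - F \<and> x \<noteq> u \<and> y \<noteq> v \<and> (u, x) \<notin> E \<and> (v, y) \<notin> E}"
    (is "_ \<le> 2 * card ?S")
proof -
  note D = reg_graphsD[OF E]
  let ?N = "\<lambda>i. {j. (i, j) \<in> E}"
  let ?swap = "\<lambda>(a::nat, b::nat). (b, a)"
  let ?T = "Sigma (insert u (?N u)) ?N"
  let ?T' = "?swap ` Sigma (insert v (?N v)) ?N"
  have fS: "finite ?S" by (rule finite_subset[OF _ D(2)]) auto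
  have fT: "finite (Sigma (insert a (?N a)) ?N)" for a using D(7) by auto
  have cT: "card (Sigma (insert a (?N a)) ?N) \<le> (d + 1) * d" for a
  proof -
    have "card (Sigma (insert a (?N a)) ?N) = (\<Sum>i\<in>insert a (?N a). card (?N i))"
      using D(7) by (subst card_SigmaI) auto
    also have "\<dots> \<le> card (insert a (?N a)) * d" 
      using D(9) sum_bounded_above[of "insert a (?N a)" "\<lambda>i. card (?N i)" d] by simp
    also have "card (insert a (?N a)) \<le> d + 1"
      using D(9)[of a] card_insert_le_m1[of "d+1" "?N a" a] by simp
    finally show ?thesis by simp
  qed
  have "E \<subseteq> ?S \<union> F \<union> ?T \<union> ?T'"
  proof
    fix e assume e: "e \<in> E"
    obtain x y where xy: "e = (x, y)" by (cases e)
    have yx: "(y, x) \<in> E" using e xy D(4) by blast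
    show "e \<in> ?S \<union> F \<union> ?T \<union> ?T'"
    proof (cases "y = v \<or> (v, y) \<in> E")
      case True
      then have "(y, x) \<in> Sigma (insert v (?N v)) ?N" using yx by auto
      then have "?swap (y, x) \<in> ?T'" by (rule imageI)
      then show ?thesis using xy by auto
    qed (use e xy in auto)
  qed
  then have "card E \<le> card (?S \<union> F \<union> ?T \<union> ?T')"
    using fS F fT by (intro card_mono) auto
  also have "\<dots> \<le> card ?S + card F + card ?T + card ?T'"
    by (intro order_trans[OF card_Un_le] add_mono order_refl)
  also have "card ?T' \<le> card (Sigma (insert v (?N v)) ?N)" by (rule card_image_le[OF fT])
  finally have "n * d \<le> card ?S + card F + 2 * ((d + 1) * d)"
    using cT[of u] cT[of v] card_reg_graph[OF E] by simp
  moreover have "(4 * (d + 1) + 2 * card F) * d \<le> n * d" using n by (rule mult_right_mono) simp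
  moreover have "(4 * (d + 1) + 2 * card F) * d = 4 * ((d + 1) * d) + 2 * (card F * d)"
    by (simp add: algebra_simps)
  moreover have "card F \<le> card F * d" using d by simp
  ultimately show ?thesis by linarith
qed

text \<open>Double counting of switches: a graph containing \<open>uv\<close> admits at least
  \<open>n * d / 2\<close> of them, while a resulting graph arises at most \<open>d * d\<close>
  times, because \<open>x\<close> is then a neighbour of \<open>u\<close> and \<open>y\<close> one
  of \<open>v\<close>.\<close>

lemma switching:
  assumes d: "d > 0" and F: "finite F" "\<And>a b. (a, b) \<in> F \<Longrightarrow> (b, a) \<in> F"
    and uv: "(u, v) \<notin> F" and n: "n \<ge> 4 * (d + 1) + 2 * card F"
  shows "n * card {E \<in> reg_graphs n d. F \<subseteq> E \<and> (u, v) \<in> E} \<le> 2 * d * card {E \<in> reg_graphs n d. F \<subseteq> E}"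
    (is "n * card ?A \<le> 2 * d * card ?B")
proof -
  define S where "S E = {(x, y). (x, y) \<in> E - F \<and> x \<noteq> u \<and> y \<noteq> v \<and> (u, x) \<notin> E \<and> (v, y) \<notin> E}" for E
  let ?f = "\<lambda>(E, x, y). (switch u v x y E, x, y)"
  let ?T = "Sigma ?B (\<lambda>E. {x. (u, x) \<in> E} \<times> {y. (v, y) \<in> E})"
  have fin: "finite ?A" "finite ?B" using finite_reg_graphs by auto
  have finS: "finite (S E)" if "E \<in> ?A" for E
    by (rule finite_subset[of _ E]) (use that reg_graphsD(2) in \<open>auto simp: S_def\<close>)
  have sw: "switch u v x y E \<in> reg_graphs n d" "switch u x v y (switch u v x y E) = E"
    if "E \<in> ?A" "(x, y) \<in> S E" for E x y
    using switch_reg_graphs[of E n d u v x y] that by (auto simp: S_def)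
  \<comment> \<open>Keeping \<open>x\<close> and \<open>y\<close> in the image lets the reverse
    switch recover \<open>E\<close>.\<close>
  have "inj_on ?f (Sigma ?A S)"
  proof (rule inj_on_inverseI)
    fix t assume "t \<in> Sigma ?A S"
    then obtain E x y where "t = (E, x, y)" "E \<in> ?A" "(x, y) \<in> S E" by (cases t) auto
    then show "(\<lambda>(E, x, y). (switch u x v y E, x, y)) (?f t) = t" using sw(2)[of E x y] by simp
  qed
  then have "card (Sigma ?A S) = card (?f ` Sigma ?A S)" by (rule card_image[symmetric])
  also have "\<dots> \<le> card ?T"
  proof (rule card_mono)
    show "finite ?T" using fin reg_graphsD(7) by auto
    show "?f ` Sigma ?A S \<subseteq> ?T"
    proof (rule image_subsetI)
      fix t assume t: "t \<in> Sigma ?A S"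
      obtain E x y where txy: "t = (E, x, y)" by (cases t)
      \<comment> \<open>None of the four removed pairs lies in \<open>F\<close>, because
        \<open>F\<close> is closed under reversal.\<close>
      have "F \<subseteq> switch u v x y E"
        using t txy uv F(2) by (auto simp: switch_def S_def)
      then show "?f t \<in> ?T" using t txy sw(1)[of E x y] by (auto simp: switch_def)
    qed
  qed
  also have "\<dots> \<le> card ?B * (d * d)"
  proof -
    have "card ?T = (\<Sum>E\<in>?B. card ({x. (u, x) \<in> E} \<times> {y. (v, y) \<in> E}))"
      using fin reg_graphsD(7) by (intro card_SigmaI) auto
    also have "\<dots> \<le> of_nat (card ?B) * (d * d)"
      by (rule sum_bounded_above) (auto simp: card_cartesian_product intro!: mult_mono reg_graphsD(9))
    finally show ?thesis by simp
  qed
  finally have up: "card (Sigma ?A S) \<le> card ?B * (d * d)" .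
  have "card ?A * (n * d) \<le> (\<Sum>E\<in>?A. 2 * card (S E))"
    using card_switchable_edges[OF _ d F(1) n] unfolding S_def
    by (intro order_trans[OF _ sum_bounded_below[where K = "n * d"]]) auto
  also have "\<dots> = 2 * card (Sigma ?A S)" using fin finS by (simp add: sum_distrib_left)
  also have "\<dots> \<le> 2 * (card ?B * (d * d))" using up by simp
  finally have "(n * card ?A) * d \<le> (2 * d * card ?B) * d" by (simp add: algebra_simps)
  then show ?thesis using d by simp
qed

text \<open>Distinctness as undirected edges, since each further edge is to cost its own factor
  \<open>2 * d / n\<close> in the switching estimate.\<close>

fun distinct_edges :: "('a \<times> 'a) list \<Rightarrow> bool" where
  "distinct_edges [] \<longleftrightarrow> True"
| "distinct_edges ((u, v) # es) \<longleftrightarrow> (u, v) \<notin> set es \<and> (v, u) \<notin> set es \<and> distinct_edges es"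

text \<open>Edges are added one at a time by \<open>switching\<close>, the earlier ones being
  protected as the set \<open>F\<close>. Divided out, the bound says that \<open>es\<close> is
  contained with probability at most \<open>(2 * d / n) ^ length es\<close>.\<close>

lemma card_reg_graphs_containing:
  assumes d: "d > 0" and "distinct_edges es" and "n \<ge> 4 * (d + 1) + 4 * length es"
  shows "n ^ length es * card {E \<in> reg_graphs n d. set es \<subseteq> E} \<le> (2 * d) ^ length es * card (reg_graphs n d)"
  using assms(2,3)
proof (induction es)
  case (Cons e es)
  obtain u v where e: "e = (u, v)" by (cases e)
  \<comment> \<open>The protected set must be closed under reversal; with both orientations it has
    at most \<open>2 * length es\<close> elements.\<close>
  let ?F = "set es \<union> (set es)\<inverse>"
  let ?B = "{E \<in> reg_graphs n d. ?F \<subseteq> E}"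
  have sym: "?F \<subseteq> E \<longleftrightarrow> set es \<subseteq> E" if "E \<in> reg_graphs n d" for E
    using reg_graphsD(4)[OF that] by (auto simp: subset_iff)
  have "card ?F \<le> card (set es) + card (set es)"
    by (rule order_trans[OF card_Un_le]) simp
  then have cF: "card ?F \<le> 2 * length es" using card_length[of es] by linarith
  have "n * card {E \<in> reg_graphs n d. ?F \<subseteq> E \<and> (u, v) \<in> E} \<le> 2 * d * card ?B"
    using Cons.prems cF e by (intro switching[OF d]) auto
  also have "{E \<in> reg_graphs n d. ?F \<subseteq> E \<and> (u, v) \<in> E} = {E \<in> reg_graphs n d. set (e # es) \<subseteq> E}"
    using sym e by auto
  also have "?B = {E \<in> reg_graphs n d. set es \<subseteq> E}" using sym by auto
  finally have step: "n * card {E \<in> reg_graphs n d. set (e # es) \<subseteq> E}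
      \<le> 2 * d * card {E \<in> reg_graphs n d. set es \<subseteq> E}" .
  have "n ^ length (e # es) * card {E \<in> reg_graphs n d. set (e # es) \<subseteq> E}
      \<le> n ^ length es * (2 * d * card {E \<in> reg_graphs n d. set es \<subseteq> E})"
    using mult_left_mono[OF step, of "n ^ length es"] by (simp add: algebra_simps)
  also have "\<dots> = 2 * d * (n ^ length es * card {E \<in> reg_graphs n d. set es \<subseteq> E})" by simp
  also have "\<dots> \<le> 2 * d * ((2 * d) ^ length es * card (reg_graphs n d))"
    using Cons.IH Cons.prems e by (intro mult_left_mono) auto
  finally show ?case by simp
qed simp

section \<open>Cycles\<close>

abbreviation walk :: "('a \<times> 'a) set \<Rightarrow> 'a list \<Rightarrow> bool" where
  "walk E \<equiv> successively (\<lambda>x y. (x, y) \<in> E)"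

text \<open>Starting from the prescribed vertex, the other \<open>l - 1\<close> are found step by
  step outwards, each with at most \<open>d\<close> choices. The induction peels off the first
  vertex, which is a neighbour of the next one; for \<open>i = 0\<close> it is the prescribed vertex
  and the next one varies.\<close>

lemma card_walks_through:
  assumes E: "E \<in> reg_graphs n d" and "i < l"
  shows "finite {w. length w = l \<and> w ! i = v \<and> walk E w}
    \<and> card {w. length w = l \<and> w ! i = v \<and> walk E w} \<le> d ^ (l - 1)"
  using assms(2)
proof (induction l arbitrary: i v)
  case (Suc l)
  let ?W = "\<lambda>l i v. {w. length w = l \<and> w ! i = v \<and> walk E w}"
  let ?N = "\<lambda>v. {j. (v, j) \<in> E}"
  note D = reg_graphsD[OF E]
  show ?case
  proof (cases "l = 0")
    case True
    then have "?W (Suc l) i v = {[v]}" using Suc.prems by (auto simp: length_Suc_conv)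
    then show ?thesis using True by simp
  next
    case l: False
    show ?thesis
    proof (cases i)
      case 0
      let ?B = "\<Union>a\<in>?N v. (#) v ` ?W l 0 a"
      have IH: "finite (?W l 0 a)" "card (?W l 0 a) \<le> d ^ (l - 1)" for a using Suc.IH[of 0 a] l by auto
      have sub: "?W (Suc l) i v \<subseteq> ?B"
        using 0 l by (auto simp: length_Suc_conv successively_Cons hd_conv_nth image_iff)
      have fin: "finite ?B" using IH D(7) by auto
      have "card ?B \<le> (\<Sum>a\<in>?N v. card ((#) v ` ?W l 0 a))" by (rule card_UN_le) (rule D(7))
      also have "\<dots> \<le> (\<Sum>a\<in>?N v. d ^ (l - 1))"
        using IH by (intro sum_mono order_trans[OF card_image_le]) auto
      also have "\<dots> \<le> d * d ^ (l - 1)" using D(9)[of v] by simp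
      also have "\<dots> = d ^ (Suc l - 1)" using l by (cases l) auto
      finally show ?thesis using finite_subset[OF sub fin] card_mono[OF fin sub] by linarith
    next
      case (Suc j)
      let ?B = "\<Union>w\<in>?W l j v. (\<lambda>a. a # w) ` ?N (hd w)"
      have "j < l" using Suc.prems Suc by simp
      then have IH: "finite (?W l j v)" "card (?W l j v) \<le> d ^ (l - 1)" using Suc.IH[of j v] by blast+
      have sub: "?W (Suc l) i v \<subseteq> ?B"
      proof
        fix w assume "w \<in> ?W (Suc l) i v"
        then obtain a w' where w: "w = a # w'" "length w' = l" "w' ! j = v" "walk E w'" "(a, hd w') \<in> E"
          using Suc l by (auto simp: length_Suc_conv successively_Cons)
        then have "a \<in> ?N (hd w')" using D(4) by blast
        then show "w \<in> ?B" using w by blast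
      qed
      have fin: "finite ?B" using IH D(7) by auto
      have "card ?B \<le> (\<Sum>w\<in>?W l j v. card ((\<lambda>a. a # w) ` ?N (hd w)))" by (rule card_UN_le) (rule IH)
      also have "\<dots> \<le> (\<Sum>w\<in>?W l j v. d)"
        using D(7,9) by (intro sum_mono order_trans[OF card_image_le]) auto
      also have "\<dots> \<le> d ^ (l - 1) * d" using IH by simp
      also have "\<dots> = d ^ (Suc l - 1)" using l by (cases l) auto
      finally show ?thesis using finite_subset[OF sub fin] card_mono[OF fin sub] by linarith
    qed
  qed
qed simp

text \<open>Cycles are rooted and oriented, so one cycle of the graph is counted several times,
  which is harmless for upper bounds. For \<open>l = 2\<close> an edge run back and forth qualifies;
  hence the bounds with \<open>l \<ge> 3\<close> below.\<close>

definition cycles :: "('a \<times> 'a) set \<Rightarrow> nat \<Rightarrow> 'a list set" where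
  "cycles E l = {c. length c = l \<and> distinct c \<and> walk E c \<and> (last c, hd c) \<in> E}"

text \<open>With the closing edge there are as many edges as vertices, which makes the powers of
  \<open>n\<close> cancel in the counts.\<close>

definition cycle_edges :: "'a list \<Rightarrow> ('a \<times> 'a) list" where
  "cycle_edges c = (last c, hd c) # zip c (tl c)"

lemma length_cycle_edges: "c \<noteq> [] \<Longrightarrow> length (cycle_edges c) = length c"
  by (simp add: cycle_edges_def)

lemma walk_iff_zip: "walk E w \<longleftrightarrow> set (zip w (tl w)) \<subseteq> E"
  by (induction w rule: induct_list012) auto

lemma cycles_iff:
  "c \<in> cycles E l \<longleftrightarrow> length c = l \<and> distinct c \<and> set (cycle_edges c) \<subseteq> E"
  by (auto simp: cycles_def cycle_edges_def walk_iff_zip)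

lemma fst_snd_cycle_edges:
  assumes "c \<noteq> []" "e \<in> set (cycle_edges c)" shows "fst e \<in> set c" "snd e \<in> set c"
proof -
  obtain a b where e: "e = (a, b)" by (cases e)
  then show "fst e \<in> set c" "snd e \<in> set c"
    using assms by (auto simp: cycle_edges_def dest: set_zip_leftD set_zip_rightD list.set_sel)
qed

lemma distinct_edges_path: "distinct c \<Longrightarrow> distinct_edges (zip c (tl c))"
proof (induction c rule: induct_list012)
  case (3 x y zs)
  then show ?case by (auto dest: set_zip_leftD set_zip_rightD)
qed auto

text \<open>From length 3 on, the first and last vertices are not consecutive in the list, so the
  closing edge is new.\<close>

lemma distinct_edges_cycle:
  assumes "distinct c" "length c \<ge> 3"
  shows "distinct_edges (cycle_edges c)"
proof -
  obtain x y z zs where c: "c = x # y # z # zs"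
    using assms(2) by (auto simp: numeral_3_eq_3 Suc_le_length_iff)
  have "last c \<in> set (z # zs)" using c by auto
  then have "last c \<noteq> x" "last c \<noteq> y" "x \<notin> set (y # z # zs)" using assms(1) c by auto
  then have "(last c, hd c) \<notin> set (zip c (tl c))" "(hd c, last c) \<notin> set (zip c (tl c))"
    unfolding c by (auto dest: set_zip_leftD set_zip_rightD)
  then show ?thesis using distinct_edges_path[OF assms(1)] by (simp add: cycle_edges_def)
qed

lemma distinct_edges_append:
  assumes "distinct_edges es" "distinct_edges fs"
    "\<And>e. e \<in> set es \<Longrightarrow> fst e \<in> A" "\<And>e. e \<in> set es \<Longrightarrow> snd e \<in> A" "\<And>e. e \<in> set fs \<Longrightarrow> fst e \<in> B" "A \<inter> B = {}"
  shows "distinct_edges (es @ fs)"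
  using assms
proof (induction es rule: distinct_edges.induct)
  case (2 u v es)
  have "(u, v) \<notin> set fs" "(v, u) \<notin> set fs" using 2(4,5)[of "(u, v)"] 2(6)[of "(u, v)"] 2(6)[of "(v, u)"] 2(7) by auto
  then show ?case using 2 by auto
qed simp

section \<open>First and second moments of the number of cycles of a given length\<close>

lemma sum_card_containing:
  assumes d: "d > 0" and n: "n \<ge> 4 * (d + 1) + 4 * m" and L: "finite L" "card L \<le> n ^ m"
    and g: "\<And>x. x \<in> L \<Longrightarrow> distinct_edges (g x) \<and> length (g x) = m"
  shows "(\<Sum>E\<in>reg_graphs n d. card {x \<in> L. set (g x) \<subseteq> E}) \<le> (2 * d) ^ m * card (reg_graphs n d)"
proof -
  let ?R = "reg_graphs n d"
  \<comment> \<open>Double counting: the edges of each \<open>x\<close> lie in a proportion of at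
    most \<open>(2 * d / n) ^ m\<close> of the graphs, and there are at most \<open>n ^ m\<close>
    such \<open>x\<close>.\<close>
  have eq: "(\<Sum>E\<in>?R. card {x \<in> L. set (g x) \<subseteq> E}) = (\<Sum>x\<in>L. card {E \<in> ?R. set (g x) \<subseteq> E})"
    by (rule sum_multicount_gen) (simp_all add: L finite_reg_graphs)
  have "n ^ m * (\<Sum>E\<in>?R. card {x \<in> L. set (g x) \<subseteq> E}) = (\<Sum>x\<in>L. n ^ m * card {E \<in> ?R. set (g x) \<subseteq> E})"
    unfolding eq by (simp add: sum_distrib_left)
  also have "\<dots> \<le> (\<Sum>x\<in>L. (2 * d) ^ m * card ?R)"
  proof (rule sum_mono)
    fix x assume "x \<in> L"
    then show "n ^ m * card {E \<in> ?R. set (g x) \<subseteq> E} \<le> (2 * d) ^ m * card ?R"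
      using card_reg_graphs_containing[OF d, of "g x" n] g[of x] n by simp
  qed
  also have "\<dots> \<le> n ^ m * ((2 * d) ^ m * card ?R)" using L by simp
  finally show ?thesis using n by simp
qed

lemma cycle_vertices:
  assumes "E \<in> reg_graphs n d" "c \<in> cycles E l" shows "set c \<subseteq> {0..<n}"
proof
  fix v assume "v \<in> set c"
  then obtain i where i: "i < length c" "v = c ! i" by (auto simp: in_set_conv_nth)
  have "\<exists>u. (v, u) \<in> E"
  proof (cases "Suc i < length c")
    case True
    then show ?thesis using assms(2) i by (auto simp: cycles_def dest: successively_nth)
  next
    case False
    then have "v = last c" using i by (cases c rule: rev_cases) (auto simp: nth_append)
    then show ?thesis using assms(2) by (auto simp: cycles_def)
  qed
  then show "v \<in> {0..<n}" using reg_graphsD(5)[OF assms(1)] by auto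
qed

lemma finite_cycles:
  assumes "E \<in> reg_graphs n d" shows "finite (cycles E l)"
proof (rule finite_subset)
  show "cycles E l \<subseteq> {c. set c \<subseteq> {0..<n} \<and> length c = l}"
    using cycle_vertices[OF assms] by (auto simp: cycles_def)
qed (simp add: finite_lists_length_eq)

text \<open>At most \<open>n ^ l\<close> vertex lists compete, each with \<open>l\<close> distinct
  edges and so with probability at most \<open>(2 * d / n) ^ l\<close>; the powers of
  \<open>n\<close> cancel.\<close>

lemma sum_card_cycles:
  assumes d: "d > 0" and n: "n \<ge> 4 * (d + 1) + 4 * l" and l: "l \<ge> 3"
  shows "(\<Sum>E\<in>reg_graphs n d. card (cycles E l)) \<le> (2 * d) ^ l * card (reg_graphs n d)"
proof -
  let ?L = "{c. set c \<subseteq> {0..<n} \<and> length c = l \<and> distinct c}"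
  let ?A = "{c. set c \<subseteq> {0..<n} \<and> length c = l}"
  have fin: "finite ?A" by (simp add: finite_lists_length_eq)
  have "cycles E l = {c \<in> ?L. set (cycle_edges c) \<subseteq> E}" if that: "E \<in> reg_graphs n d" for E
  proof (rule Set.set_eqI)
    fix c show "c \<in> cycles E l \<longleftrightarrow> c \<in> {c \<in> ?L. set (cycle_edges c) \<subseteq> E}"
      using cycle_vertices[OF that, of c l] cycles_iff[of c E l] by auto
  qed
  then have "(\<Sum>E\<in>reg_graphs n d. card (cycles E l)) =
      (\<Sum>E\<in>reg_graphs n d. card {c \<in> ?L. set (cycle_edges c) \<subseteq> E})" by simp
  also have "\<dots> \<le> (2 * d) ^ l * card (reg_graphs n d)"
  proof (rule sum_card_containing[OF d n])
    have sub: "?L \<subseteq> ?A" by auto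
    show "finite ?L" by (rule finite_subset[OF sub fin])
    show "card ?L \<le> n ^ l" using card_mono[OF fin sub] by (simp add: card_lists_length_eq)
    show "distinct_edges (cycle_edges c) \<and> length (cycle_edges c) = l" if "c \<in> ?L" for c
      using that l distinct_edges_cycle[of c] length_cycle_edges[of c] by force
  qed
  finally show ?thesis .
qed

text \<open>Vertex-disjoint cycles share no edge, so the first-moment argument applies to their
  joint list of \<open>2 * l\<close> edges.\<close>

lemma sum_card_disjoint_cycles:
  assumes d: "d > 0" and n: "n \<ge> 4 * (d + 1) + 8 * l" and l: "l \<ge> 3"
  shows "(\<Sum>E\<in>reg_graphs n d. card {(b, c). b \<in> cycles E l \<and> c \<in> cycles E l \<and> set b \<inter> set c = {}})
    \<le> (2 * d) ^ (2 * l) * card (reg_graphs n d)"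
proof -
  let ?A = "{c. set c \<subseteq> {0..<n} \<and> length c = l}"
  let ?L = "{(b, c). b \<in> ?A \<and> c \<in> ?A \<and> distinct b \<and> distinct c \<and> set b \<inter> set c = {}}"
  let ?g = "\<lambda>(b, c). cycle_edges b @ cycle_edges c"
  have fin: "finite (?A \<times> ?A)" by (simp add: finite_lists_length_eq)
  have "{(b, c). b \<in> cycles E l \<and> c \<in> cycles E l \<and> set b \<inter> set c = {}} = {x \<in> ?L. set (?g x) \<subseteq> E}"
    if that: "E \<in> reg_graphs n d" for E
  proof (rule Set.set_eqI)
    fix x :: "nat list \<times> nat list"
    obtain b c where x: "x = (b, c)" by (cases x)
    show "x \<in> {(b, c). b \<in> cycles E l \<and> c \<in> cycles E l \<and> set b \<inter> set c = {}}
        \<longleftrightarrow> x \<in> {x \<in> ?L. set (?g x) \<subseteq> E}"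
      unfolding x using cycle_vertices[OF that, of b l] cycle_vertices[OF that, of c l]
        cycles_iff[of b E l] cycles_iff[of c E l] by auto
  qed
  then have "(\<Sum>E\<in>reg_graphs n d. card {(b, c). b \<in> cycles E l \<and> c \<in> cycles E l \<and> set b \<inter> set c = {}}) =
      (\<Sum>E\<in>reg_graphs n d. card {x \<in> ?L. set (?g x) \<subseteq> E})" by simp
  also have "\<dots> \<le> (2 * d) ^ (2 * l) * card (reg_graphs n d)"
  proof (rule sum_card_containing[OF d])
    have sub: "?L \<subseteq> ?A \<times> ?A" by auto
    show "finite ?L" by (rule finite_subset[OF sub fin])
    have "card ?L \<le> card (?A \<times> ?A)" by (rule card_mono[OF fin sub])
    also have "\<dots> = n ^ (2 * l)" by (simp add: card_cartesian_product card_lists_length_eq mult_2 power_add)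
    finally show "card ?L \<le> n ^ (2 * l)" .
    show "distinct_edges (?g x) \<and> length (?g x) = 2 * l" if "x \<in> ?L" for x
    proof -
      obtain b c where x: "x = (b, c)" by (cases x)
      have "b \<noteq> []" "c \<noteq> []" using that x l by auto
      then show ?thesis
        using that x l fst_snd_cycle_edges[of b] fst_snd_cycle_edges[of c]
        by (auto simp: length_cycle_edges intro!: distinct_edges_append[where A = "set b" and B = "set c"] distinct_edges_cycle)
    qed
  qed (use n in simp)
  finally show ?thesis .
qed

text \<open>A cycle \<open>c\<close> meeting \<open>b\<close> is a walk with one of the
  \<open>l\<close> vertices of \<open>b\<close> at one of \<open>l\<close> positions, leaving at
  most \<open>d ^ (l - 1)\<close> possibilities for each choice.\<close>

lemma card_cycles_square:
  assumes E: "E \<in> reg_graphs n d" and l: "l > 0"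
  shows "(card (cycles E l))\<^sup>2 \<le> card {(b, c). b \<in> cycles E l \<and> c \<in> cycles E l \<and> set b \<inter> set c = {}}
     + l\<^sup>2 * d ^ (l - 1) * card (cycles E l)"
proof -
  let ?C = "cycles E l"
  let ?D = "{(b, c). b \<in> ?C \<and> c \<in> ?C \<and> set b \<inter> set c = {}}"
  let ?W = "\<lambda>b. \<Union>v\<in>set b. \<Union>i\<in>{..<l}. {w. length w = l \<and> w ! i = v \<and> walk E w}"
  note fin = finite_cycles[OF E, of l]
  have finW: "finite (?W b)" for b using card_walks_through[OF E, of _ l] by auto
  have cW: "card (?W b) \<le> l\<^sup>2 * d ^ (l - 1)" if "b \<in> ?C" for b
  proof -
    have "card (\<Union>i\<in>{..<l}. {w. length w = l \<and> w ! i = v \<and> walk E w}) \<le> l * d ^ (l - 1)" for v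
    proof -
      have "card (\<Union>i\<in>{..<l}. {w. length w = l \<and> w ! i = v \<and> walk E w}) \<le> (\<Sum>i<l. d ^ (l - 1))"
        using card_walks_through[OF E, of _ l v] by (rule_tac order_trans[OF card_UN_le sum_mono]) auto
      then show ?thesis by simp
    qed
    then have "card (?W b) \<le> (\<Sum>v\<in>set b. l * d ^ (l - 1))"
      by (rule_tac order_trans[OF card_UN_le sum_mono]) auto
    also have "\<dots> = l\<^sup>2 * d ^ (l - 1)"
      using that by (simp add: cycles_def distinct_card power2_eq_square)
    finally show ?thesis .
  qed
  have sub: "?C \<times> ?C \<subseteq> ?D \<union> Sigma ?C ?W"
  proof
    fix t assume t: "t \<in> ?C \<times> ?C"
    obtain b c where bc: "t = (b, c)" by (cases t)
    show "t \<in> ?D \<union> Sigma ?C ?W"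
    proof (cases "set b \<inter> set c = {}")
      case False
      then obtain v where v: "v \<in> set b" "v \<in> set c" by blast
      obtain i where i: "i < length c" "c ! i = v" using v(2) by (metis in_set_conv_nth)
      have "c \<in> {w. length w = l \<and> w ! i = v \<and> walk E w}" "i < l"
        using t bc i by (simp_all add: cycles_def)
      then have "c \<in> ?W b" using v(1) by blast
      then show ?thesis using t bc by simp
    qed (use t bc in simp)
  qed
  have "(card ?C)\<^sup>2 = card (?C \<times> ?C)" by (simp add: power2_eq_square card_cartesian_product)
  also have "\<dots> \<le> card (?D \<union> Sigma ?C ?W)"
  proof (rule card_mono[OF _ sub])
    have "finite ?D" by (rule finite_subset[of _ "?C \<times> ?C"]) (use fin in auto)
    then show "finite (?D \<union> Sigma ?C ?W)" using fin finW by auto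
  qed
  also have "\<dots> \<le> card ?D + card (Sigma ?C ?W)" by (rule card_Un_le)
  also have "card (Sigma ?C ?W) = (\<Sum>b\<in>?C. card (?W b))" using fin finW by (intro card_SigmaI) auto
  also have "\<dots> \<le> (\<Sum>b\<in>?C. l\<^sup>2 * d ^ (l - 1))" by (intro sum_mono cW)
  also have "\<dots> = l\<^sup>2 * d ^ (l - 1) * card ?C" by simp
  finally show ?thesis by simp
qed

lemma sum_card_cycles_square:
  assumes d: "d > 0" and n: "n \<ge> 4 * (d + 1) + 8 * l" and l: "l \<ge> 3"
  shows "(\<Sum>E\<in>reg_graphs n d. (card (cycles E l))\<^sup>2) \<le> (1 + l\<^sup>2) * (2 * d) ^ (2 * l) * card (reg_graphs n d)"
proof -
  let ?R = "reg_graphs n d"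
  let ?D = "\<lambda>E. {(b, c). b \<in> cycles E l \<and> c \<in> cycles E l \<and> set b \<inter> set c = {}}"
  have "(\<Sum>E\<in>?R. (card (cycles E l))\<^sup>2) \<le> (\<Sum>E\<in>?R. card (?D E) + l\<^sup>2 * d ^ (l - 1) * card (cycles E l))"
    using card_cycles_square l by (intro sum_mono) auto
  also have "\<dots> = (\<Sum>E\<in>?R. card (?D E)) + l\<^sup>2 * d ^ (l - 1) * (\<Sum>E\<in>?R. card (cycles E l))"
    by (simp add: sum.distrib sum_distrib_left)
  \<comment> \<open>Rounding \<open>d ^ (l - 1)\<close> up to \<open>(2 * d) ^ l\<close> gives both
    terms the same power.\<close>
  also have "\<dots> \<le> (2 * d) ^ (2 * l) * card ?R + l\<^sup>2 * (2 * d) ^ l * ((2 * d) ^ l * card ?R)"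
  proof (intro add_mono mult_mono order_refl)
    have "d ^ (l - 1) \<le> (2 * d) ^ (l - 1)" by (rule power_mono) auto
    also have "\<dots> \<le> (2 * d) ^ l" using d by (intro power_increasing) auto
    finally show "d ^ (l - 1) \<le> (2 * d) ^ l" .
  qed (use sum_card_disjoint_cycles[OF d n l] sum_card_cycles[OF d _ l, of n] n in auto)
  also have "\<dots> = (1 + l\<^sup>2) * (2 * d) ^ (2 * l) * card ?R"
    by (simp add: algebra_simps power_mult_distrib power_mult power2_eq_square)
  finally show ?thesis .
qed

section \<open>Nonbacktracking walks and the cycles inside them\<close>

fun nonbacktracking :: "'a list \<Rightarrow> bool" where
  "nonbacktracking (x # y # z # w) \<longleftrightarrow> x \<noteq> z \<and> nonbacktracking (y # z # w)"
| "nonbacktracking _ \<longleftrightarrow> True"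

lemma nonbacktracking_ConsD: "nonbacktracking (x # w) \<Longrightarrow> nonbacktracking w"
  by (cases "x # w" rule: nonbacktracking.cases) auto

text \<open>Passing to tails, one may assume that only the first vertex recurs. The stretch up to
  its next occurrence is then a cycle: it is not a loop by \<open>irrefl\<close>, and not a step
  there and back by nonbacktracking. The strict \<open>i + l < length w\<close> holds because the
  returning vertex is still on the walk.\<close>

lemma nonbacktracking_contains_cycle:
  assumes irrefl: "\<And>x. (x, x) \<notin> E" and "walk E w" "nonbacktracking w" "\<not> distinct w"
  shows "\<exists>i l. l \<ge> 3 \<and> i + l < length w \<and> take l (drop i w) \<in> cycles E l"
  using assms(2-)
proof (induction w)
  case (Cons x w)
  show ?case
  proof (cases "distinct w")
    case False
    then obtain i l where "l \<ge> 3" "i + l < length w" "take l (drop i w) \<in> cycles E l"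
      using Cons by (auto simp: successively_Cons dest: nonbacktracking_ConsD)
    then show ?thesis by (intro exI[of _ "Suc i"] exI[of _ l]) auto
  next
    case True
    then obtain j where j: "j < length w" "w ! j = x" using Cons.prems by (auto simp: in_set_conv_nth)
    have "w \<noteq> []" using j by auto
    then have edge: "(x, w ! 0) \<in> E" and ww: "walk E w" using Cons.prems by (auto simp: successively_Cons hd_conv_nth)
    have j0: "j \<noteq> 0" using edge j irrefl[of x] by metis
    have j1: "j \<noteq> 1"
    proof
      assume "j = 1"
      then obtain a b w' where "w = a # b # w'" using j by (cases w rule: remdups_adj.cases) auto
      then show False using \<open>j = 1\<close> j Cons.prems by auto
    qed
    have "take (Suc j) (x # w) \<in> cycles E (Suc j)"
      unfolding cycles_def
    proof (intro CollectI conjI)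
      have "x \<notin> set (take j w)" using True j by (auto simp: in_set_conv_nth nth_eq_iff_index_eq)
      then show "distinct (take (Suc j) (x # w))" using True by simp
      show "walk E (take (Suc j) (x # w))" 
        using Cons.prems(1) successively_append_iff[of _ "take (Suc j) (x # w)" "drop (Suc j) (x # w)"] by simp
      have "last (take (Suc j) (x # w)) = w ! (j - 1)" using j j0 by (cases "w = []") (auto simp: last_conv_nth)
      moreover have "(w ! (j - 1), w ! j) \<in> E" using ww j j0 successively_nth[of _ w "j - 1"] by simp
      ultimately show "(last (take (Suc j) (x # w)), hd (take (Suc j) (x # w))) \<in> E" using j by simp
    qed (use j in simp)
    then show ?thesis using j j0 j1 by (intro exI[of _ 0] exI[of _ "Suc j"]) auto
  qed
qed simp

section \<open>Eigenvalues of real symmetric matrices\<close>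

text \<open>The polynomial splits over the complex numbers; symmetry forces every root to be real,
  so the factorization descends to the reals.\<close>

lemma char_poly_real_symmetric:
  fixes A :: "real mat"
  assumes A: "A \<in> carrier_mat n n" and sym: "\<And>i j. i < n \<Longrightarrow> j < n \<Longrightarrow> A $$ (i, j) = A $$ (j, i)"
  shows "\<exists>es. char_poly A = (\<Prod>e\<leftarrow>es. [:- e, 1:]) \<and> length es = n"
proof -
  let ?C = "map_mat of_real A :: complex mat"
  have C: "?C \<in> carrier_mat n n" using A by simp
  obtain as where as: "char_poly ?C = (\<Prod>a\<leftarrow>as. [:- a, 1:])" "length as = n"
    using char_poly_factorized[OF C] by auto
  have real: "of_real (Re a) = a" if "a \<in> set as" for a
  proof -
    have "poly (char_poly ?C) a = 0"
      using that unfolding as by (auto simp: poly_prod_list prod_list_zero_iff)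
    then obtain v where v: "v \<in> carrier_vec n" "v \<noteq> 0\<^sub>v n" "?C *\<^sub>v v = a \<cdot>\<^sub>v v"
      using C unfolding eigenvalue_root_char_poly[OF C, symmetric] eigenvalue_def eigenvector_def by auto
    have row: "(\<Sum>j<n. of_real (A $$ (i, j)) * v $ j) = a * v $ i" if "i < n" for i
    proof -
      have "(?C *\<^sub>v v) $ i = a * v $ i" using v that by simp
      then show ?thesis using v(1) A that by (simp add: scalar_prod_def lessThan_atLeast0)
    qed
    \<comment> \<open>\<open>S\<close> is the Hermitian form of \<open>A\<close> at the eigenvector
      \<open>v\<close>. It equals \<open>a\<close> times the squared norm of \<open>v\<close>, and
      it is its own conjugate by symmetry of \<open>A\<close>; hence \<open>a\<close> is
      real.\<close>
    define S where "S = (\<Sum>i<n. \<Sum>j<n. cnj (v $ i) * of_real (A $$ (i, j)) * v $ j)"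
    have "S = (\<Sum>i<n. cnj (v $ i) * (\<Sum>j<n. of_real (A $$ (i, j)) * v $ j))"
      by (simp add: S_def sum_distrib_left mult.assoc)
    also have "\<dots> = (\<Sum>i<n. a * of_real ((cmod (v $ i))\<^sup>2))"
    proof (rule sum.cong)
      fix i assume "i \<in> {..<n}"
      then have "i < n" by simp
      show "cnj (v $ i) * (\<Sum>j<n. of_real (A $$ (i, j)) * v $ j) = a * of_real ((cmod (v $ i))\<^sup>2)"
        unfolding row[OF \<open>i < n\<close>] complex_norm_square by (simp only: mult_ac)
    qed simp
    also have "\<dots> = a * of_real (\<Sum>i<n. (cmod (v $ i))\<^sup>2)" by (simp add: sum_distrib_left)
    finally have S: "S = a * of_real (\<Sum>i<n. (cmod (v $ i))\<^sup>2)" .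
    have "cnj S = (\<Sum>i<n. \<Sum>j<n. cnj (v $ j) * of_real (A $$ (i, j)) * v $ i)"
      by (simp add: S_def mult_ac)
    also have "\<dots> = (\<Sum>j<n. \<Sum>i<n. cnj (v $ j) * of_real (A $$ (j, i)) * v $ i)"
      by (subst sum.swap) (auto intro!: sum.cong simp: sym)
    finally have "cnj S = S" by (simp add: S_def)
    obtain i where i: "i < n" "v $ i \<noteq> 0" using v(1,2) by (metis carrier_vecD eq_vecI index_zero_vec(1,2))
    have "(\<Sum>i<n. (cmod (v $ i))\<^sup>2) > 0" by (rule sum_pos2[of _ i]) (use i in auto)
    then have "complex_of_real (\<Sum>i<n. (cmod (v $ i))\<^sup>2) \<noteq> 0" unfolding of_real_eq_0_iff by linarith
    then have "cnj a = a" using \<open>cnj S = S\<close> unfolding S complex_cnj_mult complex_cnj_complex_of_real by (metis mult_right_cancel)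
    then show ?thesis by (metis Reals_cnj_iff of_real_Re)
  qed
  define es where "es = map Re as"
  have "map_poly of_real (char_poly A) = char_poly ?C" by (simp add: of_real_hom.char_poly_hom[OF A])
  also have "\<dots> = (\<Prod>e\<leftarrow>es. [:- of_real e, 1:])"
    unfolding as es_def using real by (auto simp: comp_def intro!: arg_cong[where f = prod_list] map_cong)
  also have "\<dots> = map_poly of_real (\<Prod>e\<leftarrow>es. [:- e, 1:])"
  proof -
    interpret map_poly_comm_ring_hom "of_real :: real \<Rightarrow> complex" ..
    show ?thesis by (simp add: hom_prod_list comp_def)
  qed
  finally have eq: "map_poly complex_of_real (char_poly A) = map_poly of_real (\<Prod>e\<leftarrow>es. [:- e, 1:])" .
  have "char_poly A = (\<Prod>e\<leftarrow>es. [:- e, 1:])"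
  proof (rule poly_eqI)
    fix i show "coeff (char_poly A) i = coeff (\<Prod>e\<leftarrow>es. [:- e, 1:]) i"
      using arg_cong[OF eq, of "\<lambda>p. coeff p i"] by (simp add: coeff_map_poly)
  qed
  then show ?thesis using as(2) by (intro exI[of _ es]) (simp add: es_def)
qed

section \<open>Traces of polynomials in a symmetric matrix as sums over its eigenvalues\<close>

definition mat_trace :: "'a::comm_semiring_1 mat \<Rightarrow> 'a" where
  "mat_trace A = (\<Sum>i<dim_row A. A $$ (i, i))"

lemma mat_trace_mult_commute:
  assumes "A \<in> carrier_mat n n" "B \<in> carrier_mat n n"
  shows "mat_trace (A * B) = mat_trace (B * A)"
proof -
  have "mat_trace (A * B) = (\<Sum>i<n. \<Sum>j<n. A $$ (i, j) * B $$ (j, i))"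
    using assms by (simp add: mat_trace_def scalar_prod_def lessThan_atLeast0)
  also have "\<dots> = (\<Sum>j<n. \<Sum>i<n. B $$ (j, i) * A $$ (i, j))"
    by (subst sum.swap) (simp add: mult.commute)
  also have "\<dots> = mat_trace (B * A)"
    using assms by (simp add: mat_trace_def scalar_prod_def lessThan_atLeast0)
  finally show ?thesis .
qed

lemma mat_trace_similar:
  assumes "P \<in> carrier_mat n n" "Q \<in> carrier_mat n n" "B \<in> carrier_mat n n" "Q * P = 1\<^sub>m n"
  shows "mat_trace (P * B * Q) = mat_trace B"
proof -
  have "mat_trace (P * B * Q) = mat_trace (Q * (P * B))"
    using assms by (intro mat_trace_mult_commute[of _ n]) auto
  also have "Q * (P * B) = (Q * P) * B" using assms by (intro assoc_mult_mat[symmetric]) auto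
  finally show ?thesis using assms by simp
qed

lemma upper_triangular_mult:
  fixes A B :: "'a::comm_semiring_1 mat"
  assumes A: "A \<in> carrier_mat n n" "upper_triangular A" and B: "B \<in> carrier_mat n n" "upper_triangular B"
  shows "upper_triangular (A * B)" and "i < n \<Longrightarrow> (A * B) $$ (i, i) = A $$ (i, i) * B $$ (i, i)"
proof -
  have idx: "(A * B) $$ (i, j) = (\<Sum>k<n. A $$ (i, k) * B $$ (k, j))" if "i < n" "j < n" for i j
    using A B that by (simp add: scalar_prod_def lessThan_atLeast0)
  have z: "A $$ (i, k) * B $$ (k, j) = 0" if "i < n" "k < n" "k < i \<or> j < k" for i j k
    using upper_triangularD[OF A(2), of k i] upper_triangularD[OF B(2), of j k] A(1) B(1) that by auto
  show "upper_triangular (A * B)"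
  proof
    fix i j assume ij: "j < i" "i < dim_row (A * B)"
    then have "i < n" "j < n" using A by auto
    then show "(A * B) $$ (i, j) = 0"
      unfolding idx[OF \<open>i < n\<close> \<open>j < n\<close>] using ij by (intro sum.neutral ballI z) auto
  qed
  assume i: "i < n"
  have "(A * B) $$ (i, i) = (\<Sum>k\<in>{i}. A $$ (i, k) * B $$ (k, i))"
    unfolding idx[OF i i] by (rule sum.mono_neutral_right) (use i z[of i _ i] in \<open>auto simp: nat_neq_iff\<close>)
  then show "(A * B) $$ (i, i) = A $$ (i, i) * B $$ (i, i)" by simp
qed

text \<open>The polynomials of the \<open>(q + 1)\<close>-regular tree that count nonbacktracking
  walks. The coefficient \<open>q + 1\<close> at \<open>r = 0\<close> appears because a walk of
  length 0 can be preceded by any of the \<open>q + 1\<close> neighbours, a longer one only by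
  \<open>q\<close> of them.\<close>

fun nb_poly :: "real \<Rightarrow> nat \<Rightarrow> real \<Rightarrow> real" where
  "nb_poly q 0 x = 1"
| "nb_poly q (Suc 0) x = x"
| "nb_poly q (Suc (Suc r)) x = x * nb_poly q (Suc r) x - (if r = 0 then q + 1 else q) * nb_poly q r x"

text \<open>This is \<open>nb_poly\<close> evaluated at a matrix, in the recursive form that walk
  counts satisfy.\<close>

fun nb_mat :: "real \<Rightarrow> nat \<Rightarrow> real mat \<Rightarrow> real mat" where
  "nb_mat q 0 A = 1\<^sub>m (dim_row A)"
| "nb_mat q (Suc 0) A = A"
| "nb_mat q (Suc (Suc r)) A = A * nb_mat q (Suc r) A - (if r = 0 then q + 1 else q) \<cdot>\<^sub>m nb_mat q r A"

lemma nb_mat_carrier [simp]: "A \<in> carrier_mat n n \<Longrightarrow> nb_mat q r A \<in> carrier_mat n n"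
proof (induction q r A rule: nb_mat.induct)
  case (3 q r A)
  then show ?case unfolding nb_mat.simps by (intro minus_carrier_mat smult_carrier_mat) blast
qed simp_all

lemma nb_mat_upper_triangular:
  assumes "B \<in> carrier_mat n n" "upper_triangular B"
  shows "upper_triangular (nb_mat q r B) \<and> (\<forall>i<n. nb_mat q r B $$ (i, i) = nb_poly q r (B $$ (i, i)))"
  using assms
proof (induction q r B rule: nb_mat.induct)
  case (3 q r B)
  let ?c = "if r = 0 then q + 1 else q"
  have c: "nb_mat q (Suc r) B \<in> carrier_mat n n" "nb_mat q r B \<in> carrier_mat n n" using 3 by auto
  note IH = 3(1)[OF 3(3,4)] 3(2)[OF 3(3,4)]
  note M = upper_triangular_mult[OF 3(3,4) c(1) conjunct1[OF IH(1)]]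
  have "upper_triangular (B * nb_mat q (Suc r) B - ?c \<cdot>\<^sub>m nb_mat q r B)"
  proof
    fix i j assume ij: "j < i" "i < dim_row (B * nb_mat q (Suc r) B - ?c \<cdot>\<^sub>m nb_mat q r B)"
    then have "i < n" "j < n" using c by auto
    moreover have "(B * nb_mat q (Suc r) B) $$ (i, j) = 0" "nb_mat q r B $$ (i, j) = 0"
      using upper_triangularD[OF M(1) ij(1)] upper_triangularD[OF conjunct1[OF IH(2)] ij(1)]
        \<open>i < n\<close> 3(3) c by (simp_all del: index_mult_mat(1))
    moreover have "dim_row (nb_mat q r B) = n" "dim_col (nb_mat q r B) = n" using c by auto
    ultimately show "(B * nb_mat q (Suc r) B - ?c \<cdot>\<^sub>m nb_mat q r B) $$ (i, j) = 0"
      by (simp del: index_mult_mat(1) nb_mat.simps)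
  qed
  moreover have "(B * nb_mat q (Suc r) B - ?c \<cdot>\<^sub>m nb_mat q r B) $$ (i, i)
      = B $$ (i, i) * nb_poly q (Suc r) (B $$ (i, i)) - ?c * nb_poly q r (B $$ (i, i))" if "i < n" for i
    using that IH M(2)[OF that] c by (simp del: index_mult_mat(1) nb_mat.simps nb_poly.simps)
  ultimately show ?case by simp
next
  case (1 q B)
  then show ?case by simp
next
  case (2 q B)
  then show ?case by simp
qed

text \<open>Conjugation is linear, and it respects products because \<open>Q * P\<close> cancels in
  the middle, so it passes through the recurrence.\<close>

lemma nb_mat_similar:
  assumes "A \<in> carrier_mat n n" "P \<in> carrier_mat n n" "Q \<in> carrier_mat n n" "B \<in> carrier_mat n n"
    "P * Q = 1\<^sub>m n" "Q * P = 1\<^sub>m n" "A = P * B * Q"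
  shows "nb_mat q r A = P * nb_mat q r B * Q"
  using assms
proof (induction q r A rule: nb_mat.induct)
  case (1 q A)
  then have "nb_mat q 0 A = P * Q" "nb_mat q 0 B = 1\<^sub>m n" by (simp_all only: nb_mat.simps carrier_matD)
  then show ?case using 1(2) by simp
next
  case (2 q A)
  then show ?case by (simp only: nb_mat.simps)
next
  case (3 q r A)
  let ?c = "if r = 0 then q + 1 else q"
  note IH = 3(1)[OF 3(3-)] 3(2)[OF 3(3-)]
  note c = 3(3,4,5,6)
  let ?X = "nb_mat q (Suc r) B" and ?Y = "nb_mat q r B"
  have XY: "?X \<in> carrier_mat n n" "?Y \<in> carrier_mat n n" using c by auto
  have BX: "B * ?X \<in> carrier_mat n n" and XQ: "?X * Q \<in> carrier_mat n n" and PX: "P * ?X \<in> carrier_mat n n"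
    and PB: "P * B \<in> carrier_mat n n" and PY: "P * ?Y \<in> carrier_mat n n" and PBX: "P * (B * ?X) \<in> carrier_mat n n"
    and PXQ: "P * ?X * Q \<in> carrier_mat n n" and Y: "?c \<cdot>\<^sub>m ?Y \<in> carrier_mat n n"
    using c XY by (meson mult_carrier_mat smult_carrier_mat)+
  have "(P * B * Q) * (P * ?X * Q) = P * B * (Q * (P * ?X * Q))"
    by (rule assoc_mult_mat[OF PB c(3) PXQ])
  also have "Q * (P * ?X * Q) = (Q * P) * (?X * Q)"
    unfolding assoc_mult_mat[OF c(2) XY(1) c(3)] by (rule assoc_mult_mat[OF c(3,2) XQ, symmetric])
  also have "\<dots> = ?X * Q" unfolding 3(8) by (rule left_mult_one_mat[OF XQ])
  also have "P * B * (?X * Q) = P * (B * ?X) * Q"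
    unfolding assoc_mult_mat[OF c(2,4) XQ] assoc_mult_mat[OF c(2) BX c(3)] assoc_mult_mat[OF c(4) XY(1) c(3)] ..
  finally have 1: "A * nb_mat q (Suc r) A = P * (B * ?X) * Q" using IH 3(9) by simp
  have "P * (B * ?X - ?c \<cdot>\<^sub>m ?Y) * Q = (P * (B * ?X) - ?c \<cdot>\<^sub>m (P * ?Y)) * Q"
    unfolding mult_minus_distrib_mat[OF c(2) BX Y] mult_smult_distrib[OF c(2) XY(2)] ..
  also have "\<dots> = P * (B * ?X) * Q - ?c \<cdot>\<^sub>m (P * ?Y * Q)"
    unfolding minus_mult_distrib_mat[OF PBX smult_carrier_mat[OF PY] c(3)] mult_smult_assoc_mat[OF PY c(3)] ..
  finally show ?case using 1 IH by simp
qed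

text \<open>Since the characteristic polynomial splits, a Schur decomposition conjugates
  \<open>A\<close> to a triangular matrix with the eigenvalues on the diagonal. There
  \<open>nb_mat\<close> acts on the diagonal as \<open>nb_poly\<close>, and the trace is invariant
  under conjugation.\<close>

lemma sum_nb_poly_eigenvalues:
  fixes A :: "real mat"
  assumes A: "A \<in> carrier_mat n n" and sym: "\<And>i j. i < n \<Longrightarrow> j < n \<Longrightarrow> A $$ (i, j) = A $$ (j, i)"
  shows "size (proots (char_poly A)) = n"
    and "(\<Sum>x\<in>#proots (char_poly A). nb_poly q r x) = mat_trace (nb_mat q r A)"
proof -
  obtain es where es: "char_poly A = (\<Prod>e\<leftarrow>es. [:- e, 1:])" "length es = n"
    using char_poly_real_symmetric[OF A sym] by auto
  have "proots (\<Prod>e\<leftarrow>es. [:- e, 1:]) = mset es"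
    

  proof (induction es)
    case (Cons a es)
    have "(\<Prod>e\<leftarrow>es. [:- e, 1:]) \<noteq> 0" by (auto simp: prod_list_zero_iff)
    then show ?case using Cons proots_mult[of "[:- a, 1:]" "\<Prod>e\<leftarrow>es. [:- e, 1:]"] by (simp del: mult_pCons_left)
  qed simp
  then have roots: "proots (char_poly A) = mset es" using es by simp
  then show "size (proots (char_poly A)) = n" using es by simp
  obtain B P Q where S: "schur_decomposition A es = (B, P, Q)" by (cases "schur_decomposition A es")
  have w: "similar_mat_wit A B P Q" "upper_triangular B" "diag_mat B = es"
    using schur_decomposition[OF A es(1) S] by auto
  have c: "P \<in> carrier_mat n n" "Q \<in> carrier_mat n n" "B \<in> carrier_mat n n"
    "P * Q = 1\<^sub>m n" "Q * P = 1\<^sub>m n" "A = P * B * Q"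
    using w(1) A unfolding similar_mat_wit_def Let_def by auto
  have "mat_trace (nb_mat q r A) = mat_trace (nb_mat q r B)"
    using nb_mat_similar[OF A c(1,2,3,4,5,6)] c by (simp add: mat_trace_similar[of _ n])
  also have "\<dots> = (\<Sum>i<n. nb_poly q r (B $$ (i, i)))"
    using nb_mat_upper_triangular[OF c(3) w(2), of q r] nb_mat_carrier[OF c(3), of q r] by (simp add: mat_trace_def)
  also have "\<dots> = (\<Sum>x\<leftarrow>es. nb_poly q r x)"
    using c(3) by (simp add: w(3)[symmetric] diag_mat_def comp_def interv_sum_list_conv_sum_set_nat lessThan_atLeast0)
  finally show "(\<Sum>x\<in>#proots (char_poly A). nb_poly q r x) = mat_trace (nb_mat q r A)"
    unfolding roots by (simp add: sum_mset_sum_list flip: mset_map)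
qed

section \<open>Closed nonbacktracking walks\<close>

text \<open>\<open>r\<close> counts steps, so the list has \<open>r + 1\<close> vertices.
  Backtracking is excluded only at interior vertices; a closed walk may retrace its last edge at the
  base point, which keeps the recurrence below exact.\<close>

definition nb_walks :: "('a \<times> 'a) set \<Rightarrow> nat \<Rightarrow> 'a \<Rightarrow> 'a \<Rightarrow> 'a list set" where
  "nb_walks E r x y = {w. length w = Suc r \<and> hd w = x \<and> last w = y \<and> walk E w \<and> nonbacktracking w}"

lemma nb_walks_0: "nb_walks E 0 x y = (if x = y then {[x]} else {})"
  by (auto simp: nb_walks_def length_Suc_conv)

lemma nb_walks_1: "nb_walks E (Suc 0) x y = (if (x, y) \<in> E then {[x, y]} else {})"
  by (auto simp: nb_walks_def length_Suc_conv)

lemma finite_nb_walks: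
  assumes "E \<in> reg_graphs n d" shows "finite (nb_walks E r x y)"
proof (rule finite_subset)
  show "nb_walks E r x y \<subseteq> {w. length w = Suc r \<and> w ! 0 = x \<and> walk E w}"
  proof
    fix w assume "w \<in> nb_walks E r x y"
    moreover from this have "w \<noteq> []" by (auto simp: nb_walks_def)
    ultimately show "w \<in> {w. length w = Suc r \<and> w ! 0 = x \<and> walk E w}"
      by (simp add: nb_walks_def hd_conv_nth)
  qed
qed (use card_walks_through[OF assms, of 0 "Suc r" x] in simp)

text \<open>Prepending a neighbour of \<open>x\<close> to a nonbacktracking walk either lengthens it or is undone by
  the first step of the walk.\<close>

lemma nb_walks_recurrence:
  assumes E: "E \<in> reg_graphs n (Suc q)" and x: "x < n"
  shows "(\<Sum>z | (x, z) \<in> E. card (nb_walks E (Suc r) z y)) =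
    card (nb_walks E (Suc (Suc r)) x y) + (if r = 0 then Suc q else q) * card (nb_walks E r x y)"
proof -
  let ?N = "{z. (x, z) \<in> E}"
  note D = reg_graphsD[OF E] and fin = finite_nb_walks[OF E]
  \<comment> \<open>\<open>T\<close> holds the walks from the neighbours of \<open>x\<close>. Those
    not stepping to \<open>x\<close> next can be prolonged by \<open>x\<close>; the others are a
    walk from \<open>x\<close> preceded by a vertex of \<open>M\<close>, which avoids the second
    vertex of that walk if there is one.\<close>
  define T where "T = (\<Union>z\<in>?N. nb_walks E (Suc r) z y)"
  define M where "M w = ?N - (if r = 0 then {} else {w ! 1})" for w
  have "disjoint_family_on (\<lambda>z. nb_walks E (Suc r) z y) ?N"
    by (auto simp: disjoint_family_on_def nb_walks_def)
  then have "(\<Sum>z\<in>?N. card (nb_walks E (Suc r) z y)) = card T"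
    unfolding T_def using D(7) fin by (intro card_UN_disjoint[symmetric]) (auto simp: disjoint_family_on_def)
  also have "T = {w \<in> T. w ! 1 \<noteq> x} \<union> {w \<in> T. w ! 1 = x}" by auto
  also have "card \<dots> = card {w \<in> T. w ! 1 \<noteq> x} + card {w \<in> T. w ! 1 = x}"
    using D(7) fin by (intro card_Un_disjoint) (auto simp: T_def)
  also have "card {w \<in> T. w ! 1 \<noteq> x} = card ((#) x ` {w \<in> T. w ! 1 \<noteq> x})"
    by (rule card_image[symmetric]) (simp add: inj_on_def)
  also have "(#) x ` {w \<in> T. w ! 1 \<noteq> x} = nb_walks E (Suc (Suc r)) x y"
  proof (intro equalityI subsetI)
    fix w assume "w \<in> (#) x ` {w \<in> T. w ! 1 \<noteq> x}"
    then obtain w' z where w: "w = x # w'" "w' ! 1 \<noteq> x" "(x, z) \<in> E" "w' \<in> nb_walks E (Suc r) z y"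
      by (auto simp: T_def)
    obtain b u where w': "w' = z # b # u" using w(4) by (auto simp: nb_walks_def length_Suc_conv)
    show "w \<in> nb_walks E (Suc (Suc r)) x y" using w unfolding w' by (auto simp: nb_walks_def)
  next
    fix w assume w: "w \<in> nb_walks E (Suc (Suc r)) x y"
    then obtain z b u where w': "w = x # z # b # u" by (auto simp: nb_walks_def length_Suc_conv)
    then have "z # b # u \<in> nb_walks E (Suc r) z y" "(x, z) \<in> E" "b \<noteq> x"
      using w by (auto simp: nb_walks_def)
    then have "z # b # u \<in> {w \<in> T. w ! 1 \<noteq> x}" by (auto simp: T_def)
    then show "w \<in> (#) x ` {w \<in> T. w ! 1 \<noteq> x}" unfolding w' by (rule imageI)
  qed
  also have "{w \<in> T. w ! 1 = x} = (\<lambda>(w, z). z # w) ` Sigma (nb_walks E r x y) M"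
  proof (intro equalityI subsetI)
    fix w assume "w \<in> {w \<in> T. w ! 1 = x}"
    then obtain z where w: "w ! 1 = x" "(x, z) \<in> E" "w \<in> nb_walks E (Suc r) z y" by (auto simp: T_def)
    obtain u where w': "w = z # x # u" using w by (auto simp: nb_walks_def length_Suc_conv)
    have "x # u \<in> nb_walks E r x y" using w unfolding w' by (auto simp: nb_walks_def dest: nonbacktracking_ConsD)
    moreover have "z \<in> M (x # u)"
      using w unfolding w' M_def by (cases u) (auto simp: nb_walks_def)
    ultimately show "w \<in> (\<lambda>(w, z). z # w) ` Sigma (nb_walks E r x y) M"
      unfolding w' by (intro image_eqI[of _ _ "(x # u, z)"]) auto
  next
    fix w assume "w \<in> (\<lambda>(w, z). z # w) ` Sigma (nb_walks E r x y) M"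
    then obtain z v where w: "w = z # v" "v \<in> nb_walks E r x y" "z \<in> M v" by auto
    obtain u where v: "v = x # u" using w(2) by (auto simp: nb_walks_def length_Suc_conv)
    have z: "(x, z) \<in> E" "(z, x) \<in> E" using w(3) D(4) by (auto simp: M_def split: if_splits)
    have "w \<in> nb_walks E (Suc r) z y"
      using w z unfolding v M_def by (cases u) (auto simp: nb_walks_def split: if_splits)
    then show "w \<in> {w \<in> T. w ! 1 = x}" using z w v by (auto simp: T_def)
  qed
  also have "card \<dots> = card (Sigma (nb_walks E r x y) M)"
    by (rule card_image) (auto simp: inj_on_def)
  also have "\<dots> = (\<Sum>w\<in>nb_walks E r x y. card (M w))"
    using fin D(7) by (intro card_SigmaI) (auto simp: M_def)
  also have "\<dots> = (\<Sum>w\<in>nb_walks E r x y. if r = 0 then Suc q else q)"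
  proof (rule sum.cong)
    fix w assume w: "w \<in> nb_walks E r x y"
    have "card ?N = Suc q" by (rule D(8)[OF x])
    moreover have "w ! 1 \<in> ?N" if "r \<noteq> 0"
      using w that by (cases r) (auto simp: nb_walks_def length_Suc_conv)
    ultimately show "card (M w) = (if r = 0 then Suc q else q)"
      using D(7) by (simp add: M_def card_Diff_singleton)
  qed simp
  finally show ?thesis by simp
qed

text \<open>Read entrywise, the matrix recurrence is \<open>nb_walks_recurrence\<close>; the first
  two cases are the identity and the adjacency matrix.\<close>

lemma nb_mat_adj_matrix:
  assumes E: "E \<in> reg_graphs n (Suc q)"
  shows "nb_mat (real q) r (adj_matrix n E) = mat n n (\<lambda>(x, y). real (card (nb_walks E r x y)))"
proof -
  let ?A = "adj_matrix n E"
  have A: "?A \<in> carrier_mat n n" by (simp add: adj_matrix_def)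
  show ?thesis
  proof (induction r rule: induct_nat_012)
    case 0
    show ?case by (rule eq_matI) (auto simp: adj_matrix_def nb_walks_0)
  next
    case 1
    show ?case by (rule eq_matI) (auto simp: adj_matrix_def nb_walks_1)
  next
    case (ge2 r)
    show ?case
    proof (rule eq_matI)
      fix x y assume "x < dim_row (mat n n (\<lambda>(x, y). real (card (nb_walks E (Suc (Suc r)) x y))))"
        and "y < dim_col (mat n n (\<lambda>(x, y). real (card (nb_walks E (Suc (Suc r)) x y))))"
      then have xy: "x < n" "y < n" by simp_all
      have "(?A * nb_mat (real q) (Suc r) ?A) $$ (x, y)
          = (\<Sum>z = 0..<n. (if (x, z) \<in> E then 1 else 0) * real (card (nb_walks E (Suc r) z y)))"
        unfolding ge2 using xy by (simp add: adj_matrix_def scalar_prod_def)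
      also have "\<dots> = (\<Sum>z | (x, z) \<in> E. real (card (nb_walks E (Suc r) z y)))"
        by (rule sum.mono_neutral_cong_right) (use reg_graphsD(6)[OF E] in auto)
      also have "\<dots> = real (card (nb_walks E (Suc (Suc r)) x y))
          + (if r = 0 then real q + 1 else real q) * real (card (nb_walks E r x y))"
        using arg_cong[OF nb_walks_recurrence[OF E xy(1), of r y], of real] by simp
      finally have "(?A * nb_mat (real q) (Suc r) ?A) $$ (x, y) = \<dots>" .
      then show "nb_mat (real q) (Suc (Suc r)) ?A $$ (x, y)
          = mat n n (\<lambda>(x, y). real (card (nb_walks E (Suc (Suc r)) x y))) $$ (x, y)"
        using xy A ge2(1) by (simp del: index_mult_mat(1) nb_mat.simps add: nb_mat.simps(3))
    qed (use A nb_mat_carrier[OF A, of q "Suc (Suc r)"] in auto)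
  qed
qed

lemma sum_nb_poly_adj_eigenvalues:
  assumes E: "E \<in> reg_graphs n (Suc q)"
  shows "size (adj_eigenvalues n E) = n"
    and "(\<Sum>x\<in>#adj_eigenvalues n E. nb_poly (real q) r x) = (\<Sum>x<n. real (card (nb_walks E r x x)))"
proof -
  have A: "adj_matrix n E \<in> carrier_mat n n" by (simp add: adj_matrix_def)
  have sym: "adj_matrix n E $$ (i, j) = adj_matrix n E $$ (j, i)" if "i < n" "j < n" for i j
    using that reg_graphsD(4)[OF E] by (auto simp: adj_matrix_def)
  show "size (adj_eigenvalues n E) = n"
    unfolding adj_eigenvalues_def by (rule sum_nb_poly_eigenvalues(1)[OF A sym])
  show "(\<Sum>x\<in>#adj_eigenvalues n E. nb_poly (real q) r x) = (\<Sum>x<n. real (card (nb_walks E r x x)))"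
    using sum_nb_poly_eigenvalues(2)[OF A sym, of "real q" r]
    by (simp add: adj_eigenvalues_def nb_mat_adj_matrix[OF E] mat_trace_def)
qed

text \<open>A closed walk repeats its base point, hence contains a cycle \<open>c\<close> of some
  length between 3 and \<open>r\<close>, starting at a position \<open>i < r\<close>. Given
  \<open>c\<close> and \<open>i\<close>, the walk has \<open>hd c\<close> at position
  \<open>i\<close>, which leaves at most \<open>d ^ r\<close> walks.\<close>

lemma card_closed_nb_walks:
  assumes E: "E \<in> reg_graphs n d" and r: "r > 0"
  shows "(\<Sum>x<n. card (nb_walks E r x x)) \<le> r * d ^ r * (\<Sum>l = 3..r. card (cycles E l))"
proof -
  note D = reg_graphsD[OF E] and fin = finite_nb_walks[OF E]
  let ?T = "\<lambda>i c. {w. length w = Suc r \<and> w ! i = hd c \<and> walk E w}"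
  let ?B = "\<Union>l\<in>{3..r}. \<Union>c\<in>cycles E l. \<Union>i\<in>{..<r}. ?T i c"
  have T: "finite (?T i c)" "card (?T i c) \<le> d ^ r" if "i < r" for i c
    using card_walks_through[OF E, of i "Suc r" "hd c"] that by simp_all
  have finB: "finite ?B" using T finite_cycles[OF E] by auto
  have "(\<Sum>x<n. card (nb_walks E r x x)) = card (\<Union>x\<in>{..<n}. nb_walks E r x x)"
    using fin by (intro card_UN_disjoint[symmetric]) (auto simp: nb_walks_def)
  also have "\<dots> \<le> card ?B"
  proof (rule card_mono[OF finB], rule subsetI)
    fix w assume "w \<in> (\<Union>x\<in>{..<n}. nb_walks E r x x)"
    then have w: "length w = Suc r" "hd w = last w" "walk E w" "nonbacktracking w"
      by (auto simp: nb_walks_def)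
    obtain a u where "w = a # u" "u \<noteq> []" using w(1) r by (cases w) auto
    then have "\<not> distinct w" using w(2) by (auto split: if_splits)
    then obtain i l where il: "l \<ge> 3" "i + l < length w" "take l (drop i w) \<in> cycles E l"
      using nonbacktracking_contains_cycle[OF D(3) w(3,4)] by blast
    have "w ! i = hd (take l (drop i w))" using il by (simp add: hd_drop_conv_nth)
    then have "w \<in> ?T i (take l (drop i w))" using w by simp
    moreover have "i < r" "l \<in> {3..r}" using il w(1) by auto
    ultimately show "w \<in> ?B" using il(3) by blast
  qed
  also have "\<dots> \<le> (\<Sum>l = 3..r. card (\<Union>c\<in>cycles E l. \<Union>i\<in>{..<r}. ?T i c))" by (rule card_UN_le) simp
  also have "\<dots> \<le> (\<Sum>l = 3..r. \<Sum>c\<in>cycles E l. card (\<Union>i\<in>{..<r}. ?T i c))"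
    by (intro sum_mono card_UN_le finite_cycles[OF E])
  also have "\<dots> \<le> (\<Sum>l = 3..r. \<Sum>c\<in>cycles E l. \<Sum>i<r. card (?T i c))"
    by (intro sum_mono card_UN_le) simp
  also have "\<dots> \<le> (\<Sum>l = 3..r. \<Sum>c\<in>cycles E l. \<Sum>i<r. d ^ r)"
    by (intro sum_mono T) simp
  also have "\<dots> = r * d ^ r * (\<Sum>l = 3..r. card (cycles E l))"
    by (simp add: sum_distrib_left mult_ac)
  finally show ?thesis .
qed

section \<open>Chebyshev moments of the semicircle law\<close>

text \<open>\<open>cheb r x\<close> is the Chebyshev polynomial of the second kind
  \<open>U_r\<close> at \<open>x / 2\<close>.\<close>

fun cheb :: "nat \<Rightarrow> real \<Rightarrow> real" where
  "cheb 0 x = 1"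
| "cheb (Suc 0) x = x"
| "cheb (Suc (Suc r)) x = x * cheb (Suc r) x - cheb r x"

lemma continuous_cheb [continuous_intros]: "continuous_on A (cheb r)"
  by (induction r rule: induct_nat_012) (auto intro!: continuous_intros)

lemma borel_measurable_cheb [measurable]: "cheb r \<in> borel_measurable borel"
  by (intro borel_measurable_continuous_onI continuous_cheb)

lemma cheb_cos: "cheb r (2 * cos t) * sin t = sin (real (Suc r) * t)"
proof (induction r rule: induct_nat_012)
  case 1
  show ?case by (simp add: sin_double)
next
  case (ge2 r)
  have "sin (real (Suc (Suc (Suc r))) * t) + sin (real (Suc r) * t)
      = 2 * sin (real (Suc (Suc r)) * t) * cos t"
    unfolding sin_plus_sin by (simp add: algebra_simps add_divide_distrib)
  then show ?case using ge2 by (simp add: algebra_simps)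
qed simp

text \<open>The antiderivative is obtained by the substitution \<open>x = 2 cos t\<close>.\<close>

lemma cheb_semicircle_has_integral:
  "((\<lambda>x. cheb r x * sqrt (4 - x\<^sup>2)) has_integral (if r = 0 then 2 * pi else 0)) {-2..2}"
proof -
  \<comment> \<open>Under the substitution the integrand becomes
    \<open>-2 * (cos (r * t) - cos ((r + 2) * t))\<close>, by the product formula for sines;
    \<open>H\<close> is the antiderivative of the bracket, with a linear term when
    \<open>r = 0\<close>.\<close>
  define H where "H t = (if r = 0 then t else sin (real r * t) / real r) - sin (real (r + 2) * t) / real (r + 2)" for t
  have dH: "(H has_real_derivative (cos (real r * t) - cos (real (r + 2) * t))) (at t)" for t
  proof (cases "r = 0")
    case True
    have "((\<lambda>t. t - sin (2 * t) / 2) has_real_derivative (1 - cos (2 * t))) (at t)"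
      by (auto intro!: derivative_eq_intros)
    then show ?thesis using True by (simp add: H_def[abs_def])
  next
    case False
    have "((\<lambda>t. sin (a * t) / a) has_real_derivative cos (a * t)) (at t)" if "a \<noteq> 0" for a
      using that by (auto intro!: derivative_eq_intros)
    from DERIV_diff[OF this[of "real r"] this[of "real (r + 2)"]] show ?thesis
      using False by (simp add: H_def[abs_def])
  qed
  have "((\<lambda>x. cheb r x * sqrt (4 - x\<^sup>2)) has_integral
      (- 2 * H (arccos (2 / 2))) - (- 2 * H (arccos (- 2 / 2)))) {-2..2}"
  \<comment> \<open>\<open>arccos\<close> is not differentiable at the end points, so the derivative
    is taken in the interior only.\<close>
  proof (rule fundamental_theorem_of_calculus_interior)
    have "continuous_on UNIV H" by (meson DERIV_continuous_on dH)
    moreover have "continuous_on {-2..2} (\<lambda>x. arccos (x / 2))"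
      by (rule continuous_on_arccos) (auto intro!: continuous_intros)
    ultimately have "continuous_on {-2..2} (\<lambda>x. H (arccos (x / 2)))"
      using continuous_on_compose2[of UNIV H] by blast
    then show "continuous_on {-2..2} (\<lambda>x. - 2 * H (arccos (x / 2)))"
      by (rule continuous_on_mult_left)
    fix x :: real assume x: "x \<in> {-2<..<2}"
    define t where "t = arccos (x / 2)"
    have t: "cos t = x / 2" "0 < t" "t < pi" using x arccos_lt_bounded[of "x / 2"] by (auto simp: t_def cos_arccos)
    have st: "sin t > 0" using t by (simp add: sin_gt_zero)
    have sq1: "sqrt (1 - (x / 2)\<^sup>2) = sin t" using st by (simp add: t(1)[symmetric] cos_squared_eq)
    have "sqrt (4 - x\<^sup>2) = 2 * sqrt (1 - (x / 2)\<^sup>2)"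
    proof -
      have "4 - x\<^sup>2 = 2\<^sup>2 * (1 - (x / 2)\<^sup>2)" by (simp add: power_divide)
      then have "sqrt (4 - x\<^sup>2) = sqrt (2\<^sup>2) * sqrt (1 - (x / 2)\<^sup>2)" by (metis real_sqrt_mult)
      then show ?thesis by simp
    qed
    then have sq: "sqrt (1 - (x / 2)\<^sup>2) = sin t" "sqrt (4 - x\<^sup>2) = 2 * sin t" by (simp_all only: sq1)
    have "((\<lambda>x. arccos (x / 2)) has_real_derivative inverse (- sqrt (1 - (x / 2)\<^sup>2)) * (1 / 2)) (at x)"
      by (rule DERIV_chain2[OF DERIV_arccos]) (use x in \<open>auto intro!: derivative_eq_intros\<close>)
    then have "((\<lambda>x. - 2 * H (arccos (x / 2))) has_real_derivative
        - 2 * ((cos (real r * t) - cos (real (r + 2) * t)) * (inverse (- sqrt (1 - (x / 2)\<^sup>2)) * (1 / 2)))) (at x)"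
      unfolding t_def by (intro DERIV_cmult DERIV_chain2[OF dH])
    also have "- 2 * ((cos (real r * t) - cos (real (r + 2) * t)) * (inverse (- sqrt (1 - (x / 2)\<^sup>2)) * (1 / 2)))
        = 2 * sin (real (Suc r) * t)"
    proof -
      have "cos (real r * t) - cos (real (r + 2) * t) = 2 * sin (real (Suc r) * t) * sin t"
        unfolding cos_diff_cos by (simp add: algebra_simps add_divide_distrib)
      then show ?thesis unfolding sq using st by (simp add: field_simps)
    qed
    also have "\<dots> = cheb r x * sqrt (4 - x\<^sup>2)"
      using cheb_cos[of r t] unfolding sq t(1) by simp
    finally show "((\<lambda>x. - 2 * H (arccos (x / 2))) has_vector_derivative cheb r x * sqrt (4 - x\<^sup>2)) (at x)"
      by (simp add: has_real_derivative_iff_has_vector_derivative)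
  qed simp
  \<comment> \<open>The sines vanish at \<open>0\<close> and \<open>pi\<close>; only the linear
    term, present for \<open>r = 0\<close>, survives.\<close>
  moreover have "(- 2 * H (arccos (2 / 2))) - (- 2 * H (arccos (- 2 / 2))) = (if r = 0 then 2 * pi else 0)"
    unfolding H_def by (auto simp: sin_add algebra_simps)
  ultimately show ?thesis by simp
qed

section \<open>The semicircle law as a probability measure, and its moments\<close>

lemma semicircle_integral:
  assumes f: "continuous_on UNIV f" and I: "((\<lambda>x. f x * sqrt (4 - x\<^sup>2)) has_integral I) {-2..2}"
  shows "integrable semicircle f" and "integral\<^sup>L semicircle f = I / (2 * pi)"
proof -
  let ?g = "\<lambda>x. indicator {-2..2} x * sqrt (4 - x\<^sup>2) / (2 * pi) :: real"
  have [measurable]: "f \<in> borel_measurable borel" using f by (rule borel_measurable_continuous_onI)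
  have nn: "?g x \<ge> 0" for x
  proof (cases "\<bar>x\<bar> \<le> 2")
    case True
    then have "x\<^sup>2 \<le> 4" using abs_le_square_iff[of x 2] by simp
    then show ?thesis by simp
  qed (auto simp: indicator_def)
  have eq: "?g x *\<^sub>R f x = indicator {-2..2} x *\<^sub>R (f x * sqrt (4 - x\<^sup>2) / (2 * pi))" for x by simp
  have "continuous_on {-2..2} (\<lambda>x. f x * sqrt (4 - x\<^sup>2) / (2 * pi))"
    by (intro continuous_intros continuous_on_subset[OF f]) auto
  then have S: "set_integrable lborel {-2..2} (\<lambda>x. f x * sqrt (4 - x\<^sup>2) / (2 * pi))"
    by (rule borel_integrable_atLeastAtMost')
  then have "integrable lborel (\<lambda>x. ?g x *\<^sub>R f x)" unfolding eq set_integrable_def .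
  then show "integrable semicircle f"
    unfolding semicircle_def using nn by (subst integrable_density) auto
  have "integral\<^sup>L semicircle f = (LINT x:{-2..2}|lborel. f x * sqrt (4 - x\<^sup>2) / (2 * pi))"
    unfolding semicircle_def set_lebesgue_integral_def using nn by (subst integral_density) (auto simp: mult_ac)
  also have "\<dots> = integral {-2..2} (\<lambda>x. f x * sqrt (4 - x\<^sup>2) / (2 * pi))"
    by (rule set_borel_integral_eq_integral(2)[OF S])
  also have "\<dots> = I / (2 * pi)"
    using has_integral_divide[OF I, of "2 * pi"] by (rule integral_unique)
  finally show "integral\<^sup>L semicircle f = I / (2 * pi)" .
qed

lemma integral_cheb_semicircle:
  "integrable semicircle (cheb r)" "integral\<^sup>L semicircle (cheb r) = (if r = 0 then 1 else 0)"
  using semicircle_integral[OF continuous_cheb cheb_semicircle_has_integral[of r]] by auto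

lemma prob_space_semicircle: "prob_space semicircle"
proof
  \<comment> \<open>The total mass is the Chebyshev integral for \<open>r = 0\<close>.\<close>
  let ?c = "\<lambda>x::real. 1::real"
  have i: "integrable semicircle ?c" "integral\<^sup>L semicircle ?c = 1"
    using integral_cheb_semicircle[of 0] by (simp_all add: cheb.simps(1)[abs_def])
  have "emeasure semicircle (space semicircle) = (\<integral>\<^sup>+ x. ennreal (?c x) \<partial>semicircle)" by simp
  also have "\<dots> = ennreal (integral\<^sup>L semicircle ?c)" by (rule nn_integral_eq_integral) (use i in auto)
  finally show "emeasure semicircle (space semicircle) = 1" using i by simp
qed

lemma sets_semicircle [simp, measurable_cong]: "sets semicircle = sets borel"
  by (simp add: semicircle_def)

lemma AE_semicircle: "AE x in semicircle. \<bar>x\<bar> \<le> 2"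
  unfolding semicircle_def by (subst AE_density) (auto simp: indicator_def)

lemma integrable_semicircle:
  assumes f: "continuous_on UNIV (f :: real \<Rightarrow> real)"
  shows "integrable semicircle f"
proof -
  have "continuous_on {-2..2} (\<lambda>x. f x * sqrt (4 - x\<^sup>2))"
    by (intro continuous_intros continuous_on_subset[OF f]) auto
  then show ?thesis using semicircle_integral(1)[OF f] integrable_continuous_interval integrable_integral by blast
qed

text \<open>\<open>x\<close> times a Chebyshev polynomial is the sum of its two neighbours.\<close>

lemma moments_tendsto:
  fixes \<mu> :: "nat \<Rightarrow> real measure"
  assumes int: "\<And>n f. continuous_on UNIV f \<Longrightarrow> integrable (\<mu> n) (f :: real \<Rightarrow> real)"
    and cheb: "\<And>r. (\<lambda>n. integral\<^sup>L (\<mu> n) (cheb r)) \<longlonglongrightarrow> integral\<^sup>L semicircle (cheb r)"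
  shows "(\<lambda>n. integral\<^sup>L (\<mu> n) (\<lambda>x. x ^ k)) \<longlonglongrightarrow> integral\<^sup>L semicircle (\<lambda>x. x ^ k)"
proof -
  have "(\<lambda>n. integral\<^sup>L (\<mu> n) (\<lambda>x. x ^ k * cheb r x)) \<longlonglongrightarrow> integral\<^sup>L semicircle (\<lambda>x. x ^ k * cheb r x)" for r
  proof (induction k arbitrary: r)
    case 0
    show ?case using cheb[of r] by simp
  next
    case (Suc k)
    show ?case
    proof (cases r)
      case 0
      then show ?thesis using Suc.IH[of 1] by (simp add: mult.commute)
    next
      case (Suc s)
      have eq: "x ^ Suc k * cheb r x = x ^ k * cheb (Suc r) x + x ^ k * cheb s x" for x
        using Suc by (simp add: algebra_simps)
      have "integral\<^sup>L M (\<lambda>x. x ^ Suc k * cheb r x)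
          = integral\<^sup>L M (\<lambda>x. x ^ k * cheb (Suc r) x) + integral\<^sup>L M (\<lambda>x. x ^ k * cheb s x)"
        if "\<And>f. continuous_on UNIV f \<Longrightarrow> integrable M (f :: real \<Rightarrow> real)" for M
        unfolding eq by (intro Bochner_Integration.integral_add that continuous_intros)
      then show ?thesis
        using tendsto_add[OF Suc.IH[of "Suc r"] Suc.IH[of s]] int integrable_semicircle by simp
    qed
  qed
  from this[of 0] show ?thesis by simp
qed

text \<open>The law lives on \<open>[-2, 2]\<close>. This geometric growth supplies the moment bound
  for the Taylor argument on characteristic functions.\<close>

lemma semicircle_even_moment_le: "integral\<^sup>L semicircle (\<lambda>x. x ^ (2 * N)) \<le> 2 ^ (2 * N)"
proof -
  interpret prob_space semicircle by (rule prob_space_semicircle)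
  have "integral\<^sup>L semicircle (\<lambda>x. x ^ (2 * N)) \<le> integral\<^sup>L semicircle (\<lambda>x. 2 ^ (2 * N))"
  proof (rule integral_mono_AE)
    show "AE x in semicircle. x ^ (2 * N) \<le> (2::real) ^ (2 * N)"
      using AE_semicircle
    proof eventually_elim
      case (elim x)
      then have "\<bar>x\<bar> ^ (2 * N) \<le> 2 ^ (2 * N)" by (intro power_mono) auto
      then show ?case by (simp add: power_even_abs)
    qed
  qed (auto intro!: integrable_semicircle continuous_intros)
  also have "\<dots> = 2 ^ (2 * N)" using prob_space by simp
  finally show ?thesis .
qed

section \<open>From moments to the Wasserstein distance\<close>

text \<open>By Levy continuity it suffices to treat characteristic functions. These are approximated
  by Taylor polynomials, whose coefficients are moments and converge; the factorial in the remainder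
  beats the geometric growth of the even moments.\<close>

lemma weak_conv_if_moments_tendsto:
  fixes \<mu> :: "nat \<Rightarrow> real measure"
  assumes dist: "\<And>n. real_distribution (\<mu> n)" "real_distribution \<nu>"
    and int: "\<And>n k. integrable (\<mu> n) (\<lambda>x. x ^ k)" "\<And>k. integrable \<nu> (\<lambda>x. x ^ k)"
    and lim: "\<And>k. (\<lambda>n. integral\<^sup>L (\<mu> n) (\<lambda>x. x ^ k)) \<longlonglongrightarrow> integral\<^sup>L \<nu> (\<lambda>x. x ^ k)"
    and bound: "\<And>k. integral\<^sup>L \<nu> (\<lambda>x. x ^ (2 * k)) \<le> B ^ (2 * k)"
  shows "weak_conv_m \<mu> \<nu>"
proof (rule levy_continuity[OF dist])
  fix t :: real
  \<comment> \<open>\<open>T\<close> is the Taylor polynomial of the characteristic function. The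
    even order \<open>2 * N\<close> turns the absolute moment in the remainder into an ordinary
    one.\<close>
  define T where "T M N = (\<Sum>k\<le>2 * N. ((\<i> * t) ^ k / fact k) * complex_of_real (integral\<^sup>L M (\<lambda>x::real. x ^ k)))" for M N
  have approx: "cmod (char M t - T M N) \<le> 2 * \<bar>t\<bar> ^ (2 * N) / fact (2 * N) * integral\<^sup>L M (\<lambda>x. x ^ (2 * N))"
    if "real_distribution M" "\<And>k. integrable M (\<lambda>x. x ^ k)" for M N
    using real_distribution.char_approx1[OF that(1), of "2 * N" t] that(2) by (simp add: T_def power_even_abs)
  show "(\<lambda>n. char (\<mu> n) t) \<longlonglongrightarrow> char \<nu> t"
  proof (rule metric_LIMSEQ_I)
    fix e :: real assume e: "e > 0"
    \<comment> \<open>\<open>c (2 * N)\<close> bounds the two remainders together: the moment of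
      \<open>\<mu> n\<close> is eventually below \<open>B ^ (2 * N) + 1\<close>, that of the limit
      at most \<open>B ^ (2 * N)\<close>.\<close>
    define c where "c N = 2 * \<bar>t\<bar> ^ N / fact N * (B ^ N + 1) + 2 * \<bar>t\<bar> ^ N / fact N * B ^ N" for N
    have z: "(\<lambda>N. x ^ N / fact N) \<longlonglongrightarrow> 0" for x :: real
      using summable_LIMSEQ_zero[OF summable_exp[of x]] by (simp add: field_simps)
    have "(\<lambda>N. 4 * ((\<bar>t\<bar> * B) ^ N / fact N) + 2 * (\<bar>t\<bar> ^ N / fact N)) \<longlonglongrightarrow> 4 * 0 + 2 * 0"
      by (intro tendsto_intros z)
    then have "c \<longlonglongrightarrow> 0" by (simp add: c_def[abs_def] algebra_simps power_mult_distrib add_divide_distrib)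
    then have "eventually (\<lambda>N. c N < e / 2) sequentially" using e by (intro order_tendstoD(2)[of c 0]) auto
    then obtain N0 where "\<And>N. N \<ge> N0 \<Longrightarrow> c N < e / 2" by (auto simp: eventually_sequentially)
    then obtain N where N: "c (2 * N) < e / 2" by (metis le_add2 mult_2)
    have "(\<lambda>n. T (\<mu> n) N) \<longlonglongrightarrow> T \<nu> N" unfolding T_def by (intro tendsto_intros lim)
    then have "eventually (\<lambda>n. dist (T (\<mu> n) N) (T \<nu> N) < e / 2) sequentially" using e by (intro tendstoD) auto
    moreover have "eventually (\<lambda>n. integral\<^sup>L (\<mu> n) (\<lambda>x. x ^ (2 * N)) < B ^ (2 * N) + 1) sequentially"
      using bound[of N] by (intro order_tendstoD(2)[OF lim]) auto
    ultimately have "eventually (\<lambda>n. dist (char (\<mu> n) t) (char \<nu> t) < e) sequentially"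
    proof eventually_elim
      case (elim n)
      let ?k = "2 * \<bar>t\<bar> ^ (2 * N) / fact (2 * N)"
      have k: "?k \<ge> 0" by simp
      have "cmod (char (\<mu> n) t - T (\<mu> n) N) \<le> ?k * (B ^ (2 * N) + 1)"
        using approx[OF dist(1) int(1), of n N] mult_left_mono[OF less_imp_le[OF elim(2)] k] by linarith
      moreover have "cmod (char \<nu> t - T \<nu> N) \<le> ?k * B ^ (2 * N)"
        using approx[OF dist(2) int(2), of N] mult_left_mono[OF bound[of N] k] by linarith
      ultimately have "cmod (char (\<mu> n) t - T (\<mu> n) N) + cmod (char \<nu> t - T \<nu> N) < e / 2"
        using N by (simp add: c_def)
      moreover have "dist (char (\<mu> n) t) (char \<nu> t)
          \<le> cmod (char (\<mu> n) t - T (\<mu> n) N) + dist (T (\<mu> n) N) (T \<nu> N) + cmod (char \<nu> t - T \<nu> N)"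
        by (metis (no_types, opaque_lifting) dist_commute dist_norm dist_triangle2 dist_triangle_le add_mono order_refl add.commute)
      ultimately show ?case using elim(1) by linarith
    qed
    then show "\<exists>no. \<forall>n\<ge>no. dist (char (\<mu> n) t) (char \<nu> t) < e" by (simp add: eventually_sequentially)
  qed
qed

text \<open>Beyond \<open>K\<close>, the factor \<open>x powr (p - 2 * m)\<close> has a negative
  exponent and is at most \<open>K powr (p - 2 * m)\<close>.\<close>

lemma powr_le_truncation:
  fixes x K p :: real
  assumes "0 \<le> x" "0 < K" "0 < p" "p < 2 * real m"
  shows "x powr p \<le> min x K powr p + K powr (p - 2 * m) * x ^ (2 * m)"
proof (cases "x \<le> K")
  case False
  then have x: "x > 0" using assms by simp
  have "x powr p = x powr (p - 2 * m) * x powr (2 * m)" by (simp flip: powr_add)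
  also have "\<dots> = x powr (p - 2 * m) * x ^ (2 * m)" using x by (simp flip: powr_realpow)
  also have "\<dots> \<le> K powr (p - 2 * m) * x ^ (2 * m)"
    using False assms by (intro mult_right_mono powr_mono2') auto
  finally show ?thesis by (simp add: add_increasing)
qed (use assms in simp)

text \<open>A bounded moment of higher order gives uniform integrability: \<open>K\<close> is chosen
  so that the tail above it contributes less than \<open>e / 2\<close> for all \<open>n\<close>, and
  the truncated part tends to \<open>0\<close> by dominated convergence.\<close>

lemma tendsto_Lp_if_bounded_moments:
  fixes D :: "nat \<Rightarrow> 'a \<Rightarrow> real"
  assumes "prob_space M" and meas [measurable]: "\<And>n. D n \<in> borel_measurable M"
    and nonneg: "\<And>n x. D n x \<ge> 0" and lim: "\<And>x. x \<in> space M \<Longrightarrow> (\<lambda>n. D n x) \<longlonglongrightarrow> 0"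
    and p: "0 < p" "p < 2 * real m"
    and int: "\<And>n. integrable M (\<lambda>x. D n x ^ (2 * m))" and C: "\<And>n. integral\<^sup>L M (\<lambda>x. D n x ^ (2 * m)) \<le> C"
    and e: "e > 0"
  shows "eventually (\<lambda>n. (\<integral>\<^sup>+ x. ennreal (D n x powr p) \<partial>M) \<le> ennreal e) sequentially"
proof -
  interpret prob_space M by fact
  have "((\<lambda>K. K powr (p - 2 * m) * C) \<longlongrightarrow> 0 * C) at_top"
    by (intro tendsto_mult tendsto_neg_powr tendsto_const filterlim_ident) (use p in simp)
  then have "eventually (\<lambda>K. K powr (p - 2 * m) * C < e / 2) at_top" using e by (intro order_tendstoD(2)) auto
  then have "eventually (\<lambda>K. K powr (p - 2 * m) * C < e / 2 \<and> K > 0) at_top"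
    using eventually_gt_at_top[of 0] by (rule eventually_conj)
  then obtain K where K: "K powr (p - 2 * m) * C < e / 2" "K > 0"
    using eventually_happens'[of "at_top :: real filter"] by auto
  have intK: "integrable M (\<lambda>x. min (D n x) K powr p)" for n
    by (rule integrable_const_bound[where B = "K powr p"])
      (use K nonneg p in \<open>auto intro!: AE_I2 powr_mono2 simp: min_le_iff_disj\<close>)
  have "(\<lambda>n. integral\<^sup>L M (\<lambda>x. min (D n x) K powr p)) \<longlonglongrightarrow> integral\<^sup>L M (\<lambda>x. 0)"
  proof (rule integral_dominated_convergence[where w = "\<lambda>_. K powr p"])
    show "AE x in M. (\<lambda>n. min (D n x) K powr p) \<longlonglongrightarrow> 0"
    proof (rule AE_I2)
      fix x assume "x \<in> space M"
      then have "(\<lambda>n. min (D n x) K) \<longlonglongrightarrow> min 0 K" by (intro tendsto_min lim tendsto_const)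
      then show "(\<lambda>n. min (D n x) K powr p) \<longlonglongrightarrow> 0"
        using K nonneg p by (intro tendsto_zero_powrI[where b = p]) auto
    qed
    show "AE x in M. norm (min (D n x) K powr p) \<le> K powr p" for n
      using K nonneg p by (auto intro!: AE_I2 powr_mono2 simp: min_le_iff_disj)
  qed auto
  then have "eventually (\<lambda>n. integral\<^sup>L M (\<lambda>x. min (D n x) K powr p) < e / 2) sequentially"
    using e by (intro order_tendstoD(2)) auto
  then show ?thesis
  proof eventually_elim
    case (elim n)
    let ?f = "\<lambda>x. min (D n x) K powr p + K powr (p - 2 * m) * D n x ^ (2 * m)"
    have f: "integrable M ?f" using intK int by auto
    have "(\<integral>\<^sup>+ x. ennreal (D n x powr p) \<partial>M) \<le> (\<integral>\<^sup>+ x. ennreal (?f x) \<partial>M)"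
      by (intro nn_integral_mono ennreal_leI powr_le_truncation nonneg K p)
    also have "\<dots> = ennreal (integral\<^sup>L M ?f)"
      by (rule nn_integral_eq_integral[OF f]) (use nonneg in \<open>auto intro!: AE_I2 add_nonneg_nonneg\<close>)
    also have "integral\<^sup>L M ?f \<le> e"
    proof -
      have "integral\<^sup>L M ?f = integral\<^sup>L M (\<lambda>x. min (D n x) K powr p)
          + K powr (p - 2 * m) * integral\<^sup>L M (\<lambda>x. D n x ^ (2 * m))"
        using intK int by simp
      also have "K powr (p - 2 * m) * integral\<^sup>L M (\<lambda>x. D n x ^ (2 * m)) \<le> K powr (p - 2 * m) * C"
        using C by (intro mult_left_mono) auto
      finally show ?thesis using elim K by linarith
    qed
    finally show ?case by (simp add: ennreal_leI)
  qed
qed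

text \<open>Skorohod's theorem realizes the weak convergence pointwise on one probability space. The
  joint law of \<open>X n\<close> and \<open>Y\<close> is a coupling, so its cost bounds the
  infimum.\<close>

lemma wasserstein_tendsto_0:
  fixes \<mu> :: "nat \<Rightarrow> real measure"
  assumes dist: "\<And>n. real_distribution (\<mu> n)" "real_distribution \<nu>"
    and int: "\<And>n k. integrable (\<mu> n) (\<lambda>x. x ^ k)" "\<And>k. integrable \<nu> (\<lambda>x. x ^ k)"
    and lim: "\<And>k. (\<lambda>n. integral\<^sup>L (\<mu> n) (\<lambda>x. x ^ k)) \<longlonglongrightarrow> integral\<^sup>L \<nu> (\<lambda>x. x ^ k)"
    and weak: "weak_conv_m \<mu> \<nu>" and p: "p \<ge> 1"
  shows "(\<lambda>n. wasserstein p (\<mu> n) \<nu>) \<longlonglongrightarrow> 0"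
proof -
  obtain \<Omega> :: "real measure" and X Y where \<Omega>: "prob_space \<Omega>"
    and X [measurable]: "\<And>n. X n \<in> borel_measurable \<Omega>" and dX: "\<And>n. distr \<Omega> borel (X n) = \<mu> n"
    and Y [measurable]: "Y \<in> borel_measurable \<Omega>" and dY: "distr \<Omega> borel Y = \<nu>"
    and XY: "\<And>x. x \<in> space \<Omega> \<Longrightarrow> (\<lambda>n. X n x) \<longlonglongrightarrow> Y x"
    using Skorohod[OF dist weak] by force
  interpret prob_space \<Omega> by fact
  let ?D = "\<lambda>n x. \<bar>X n x - Y x\<bar>"
  \<comment> \<open>An even exponent above \<open>p\<close>: the moment of that order controls the
    tails of \<open>X n - Y\<close>.\<close>
  obtain m :: nat where m: "p < 2 * real m" using reals_Archimedean2[of "p / 2"] by (auto simp: field_simps)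
  have iX: "integrable \<Omega> (\<lambda>x. X n x ^ k)" "integral\<^sup>L \<Omega> (\<lambda>x. X n x ^ k) = integral\<^sup>L (\<mu> n) (\<lambda>x. x ^ k)" for n k
    using int(1)[of n k] by (auto simp: integrable_distr_eq integral_distr simp flip: dX)
  have iY: "integrable \<Omega> (\<lambda>x. Y x ^ k)" "integral\<^sup>L \<Omega> (\<lambda>x. Y x ^ k) = integral\<^sup>L \<nu> (\<lambda>x. x ^ k)" for k
    using int(2)[of k] by (auto simp: integrable_distr_eq integral_distr simp flip: dY)
  have le: "?D n x ^ (2 * m) \<le> 2 ^ (2 * m) * (X n x ^ (2 * m) + Y x ^ (2 * m))" for n x
  proof -
    have "?D n x ^ (2 * m) \<le> (2 * max \<bar>X n x\<bar> \<bar>Y x\<bar>) ^ (2 * m)" by (intro power_mono) auto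
    also have "\<dots> = 2 ^ (2 * m) * max \<bar>X n x\<bar> \<bar>Y x\<bar> ^ (2 * m)" by (simp add: power_mult_distrib)
    also have "max \<bar>X n x\<bar> \<bar>Y x\<bar> ^ (2 * m) \<le> X n x ^ (2 * m) + Y x ^ (2 * m)"
      by (auto simp: max_def power_even_abs)
    finally show ?thesis by simp
  qed
  have iD: "integrable \<Omega> (\<lambda>x. ?D n x ^ (2 * m))" for n
    by (rule Bochner_Integration.integrable_bound[of _ "\<lambda>x. 2 ^ (2 * m) * (X n x ^ (2 * m) + Y x ^ (2 * m))"])
      (use iX iY le in \<open>auto intro!: AE_I2 simp: power_even_abs\<close>)
  obtain C where C: "\<And>n. integral\<^sup>L (\<mu> n) (\<lambda>x. x ^ (2 * m)) \<le> C"
    using convergent_imp_Bseq[OF convergentI[OF lim[of "2 * m"]]] by (metis BseqE abs_le_D1 real_norm_def)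
  have bD: "integral\<^sup>L \<Omega> (\<lambda>x. ?D n x ^ (2 * m)) \<le> 2 ^ (2 * m) * (C + integral\<^sup>L \<nu> (\<lambda>x. x ^ (2 * m)))" for n
  proof -
    have "integral\<^sup>L \<Omega> (\<lambda>x. ?D n x ^ (2 * m)) \<le> integral\<^sup>L \<Omega> (\<lambda>x. 2 ^ (2 * m) * (X n x ^ (2 * m) + Y x ^ (2 * m)))"
      using iX iY iD le by (intro integral_mono) auto
    also have "\<dots> = 2 ^ (2 * m) * (integral\<^sup>L (\<mu> n) (\<lambda>x. x ^ (2 * m)) + integral\<^sup>L \<nu> (\<lambda>x. x ^ (2 * m)))"
      using iX iY by simp
    finally show ?thesis using C[of n] by (smt (verit) mult_left_mono zero_le_power)
  qed
  define I where "I n = (INF \<gamma>\<in>couplings (\<mu> n) \<nu>. \<integral>\<^sup>+ z. ennreal (\<bar>fst z - snd z\<bar> powr p) \<partial>\<gamma>)" for n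
  have I: "I n \<le> (\<integral>\<^sup>+ x. ennreal (?D n x powr p) \<partial>\<Omega>)" for n
  proof -
    let ?g = "distr \<Omega> borel (\<lambda>x. (X n x, Y x))"
    have m [measurable]: "(\<lambda>x. (X n x, Y x)) \<in> measurable \<Omega> (borel :: (real \<times> real) measure)" by simp
    have fs: "fst \<in> borel_measurable (borel :: (real \<times> real) measure)" "snd \<in> borel_measurable (borel :: (real \<times> real) measure)"
      by (intro borel_measurable_continuous_onI continuous_intros)+
    \<comment> \<open>The marginals of the joint law are the laws of \<open>X n\<close> and
      \<open>Y\<close>.\<close>
    have "?g \<in> couplings (\<mu> n) \<nu>"
      unfolding couplings_def by (auto simp: prob_space_distr[OF m] distr_distr[OF fs(1) m] distr_distr[OF fs(2) m] comp_def dX dY)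
    then have "I n \<le> (\<integral>\<^sup>+ z. ennreal (\<bar>fst z - snd z\<bar> powr p) \<partial>?g)" unfolding I_def by (rule INF_lower)
    also have "\<dots> = (\<integral>\<^sup>+ x. ennreal (?D n x powr p) \<partial>\<Omega>)" using fs by (subst nn_integral_distr) auto
    finally show ?thesis .
  qed
  have "(\<lambda>n. enn2real (I n)) \<longlonglongrightarrow> 0"
  proof (rule metric_LIMSEQ_I)
    fix e :: real assume e: "e > 0"
    have "eventually (\<lambda>n. (\<integral>\<^sup>+ x. ennreal (?D n x powr p) \<partial>\<Omega>) \<le> ennreal (e / 2)) sequentially"
    proof (rule tendsto_Lp_if_bounded_moments[OF \<Omega> _ _ _ _ m iD bD])
      show "(\<lambda>n. ?D n x) \<longlonglongrightarrow> 0" if "x \<in> space \<Omega>" for x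
        using tendsto_rabs[OF tendsto_diff[OF XY[OF that] tendsto_const[of "Y x"]]] by simp
    qed (use p e in auto)
    then have "eventually (\<lambda>n. dist (enn2real (I n)) 0 < e) sequentially"
    proof eventually_elim
      case (elim n)
      then have "enn2real (I n) \<le> enn2real (ennreal (e / 2))" using I[of n] by (intro enn2real_mono) auto
      then show ?case using e by simp
    qed
    then show "\<exists>no. \<forall>n\<ge>no. dist (enn2real (I n)) 0 < e" by (simp add: eventually_sequentially)
  qed
  then show ?thesis
    unfolding wasserstein_def I_def[symmetric] by (rule tendsto_zero_powrI[where b = "1 / p"]) (use p in auto)
qed

section \<open>Random regular graphs\<close>

lemma sum_mset_conv_sum_count:
  fixes f :: "'a \<Rightarrow> real"
  assumes "finite A" "set_mset M \<subseteq> A"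
  shows "(\<Sum>x\<in>#M. f x) = (\<Sum>a\<in>A. real (count M a) * f a)"
  using assms(2)
proof (induction M)
  case (add x M)
  have "(\<Sum>a\<in>A. real (count (add_mset x M) a) * f a)
      = (\<Sum>a\<in>A. real (count M a) * f a + (if a = x then f a else 0))"
    by (rule sum.cong) (auto simp: algebra_simps)
  also have "\<dots> = (\<Sum>a\<in>A. real (count M a) * f a) + f x"
    using add assms(1) by (simp add: sum.distrib)
  finally show ?case using add by simp
qed simp

lemma spectral_measure_integral:
  assumes size: "size (adj_eigenvalues n E) = n" and n: "n > 0" and f [measurable]: "f \<in> borel_measurable borel"
  shows "real_distribution (spectral_measure q n E)" and "integrable (spectral_measure q n E) (f :: real \<Rightarrow> real)"
    and "integral\<^sup>L (spectral_measure q n E) f = (\<Sum>x\<in>#adj_eigenvalues n E. f (x / sqrt (real q))) / real n"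
proof -
  let ?X = "image_mset (\<lambda>l. l / sqrt (real q)) (adj_eigenvalues n E)"
  let ?P = "pmf_of_multiset ?X"
  have X: "?X \<noteq> {#}" using size n by auto
  have fin: "finite (set_pmf ?P)" using X by simp
  show "real_distribution (spectral_measure q n E)"
    unfolding spectral_measure_def 
    by (rule prob_space.real_distribution_distr[OF prob_space_measure_pmf]) simp
  show "integrable (spectral_measure q n E) f"
    unfolding spectral_measure_def by (subst integrable_distr_eq) (use fin in \<open>auto intro: integrable_measure_pmf_finite\<close>)
  have "integral\<^sup>L (spectral_measure q n E) f = integral\<^sup>L (measure_pmf ?P) f"
    unfolding spectral_measure_def by (subst integral_distr) auto
  also have "\<dots> = (\<Sum>a\<in>set_mset ?X. f a * pmf ?P a)"
    by (rule integral_measure_pmf_real) (use X in auto)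
  also have "\<dots> = (\<Sum>a\<in>set_mset ?X. real (count ?X a) * f a) / real n"
    using X size by (simp add: pmf_of_multiset sum_divide_distrib mult.commute)
  also have "\<dots> = (\<Sum>x\<in>#?X. f x) / real n" by (subst sum_mset_conv_sum_count[of "set_mset ?X"]) auto
  finally show "integral\<^sup>L (spectral_measure q n E) f = (\<Sum>x\<in>#adj_eigenvalues n E. f (x / sqrt (real q))) / real n"
    by (simp add: image_mset.compositionality comp_def)
qed

text \<open>This is \<open>nb_poly\<close> after rescaling the variable by \<open>sqrt q\<close> and
  dividing by the \<open>r\<close>-th power of \<open>sqrt q\<close>. The term with
  \<open>1 / q\<close> is a correction that vanishes in the limit.\<close>

definition nb_cheb :: "nat \<Rightarrow> nat \<Rightarrow> real \<Rightarrow> real" where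
  "nb_cheb q r x = cheb r x - (if r < 2 then 0 else cheb (r - 2) x / real q)"

lemma nb_poly_eq_nb_cheb:
  assumes q: "q > 0"
  shows "nb_poly (real q) r x = sqrt (real q) ^ r * nb_cheb q r (x / sqrt (real q))"
proof -
  let ?s = "sqrt (real q)"
  have s: "?s \<noteq> 0" "?s * ?s = real q" using q by auto
  show ?thesis
  proof (induction r rule: induct_nat_012)
    case (ge2 r)
    consider "r = 0" | "r = 1" | k where "r = Suc (Suc k)" by (metis One_nat_def not0_implies_Suc)
    then show ?case
    proof cases
      \<comment> \<open>From here on both families follow a plain Chebyshev recurrence. The two
        lower cases are computed directly, because of the coefficient \<open>q + 1\<close> and the
        missing subtracted terms.\<close>
      case 3
      have a: "nb_cheb q (Suc (Suc r)) y = y * nb_cheb q (Suc r) y - nb_cheb q r y" for y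
        unfolding 3 by (simp add: nb_cheb_def algebra_simps diff_divide_distrib)
      have "nb_poly (real q) (Suc (Suc r)) x = x * nb_poly (real q) (Suc r) x - real q * nb_poly (real q) r x"
        using 3 by simp
      also have "\<dots> = ?s ^ Suc (Suc r) * nb_cheb q (Suc (Suc r)) (x / ?s)"
        unfolding ge2 a using s by (simp add: field_simps)
      finally show ?thesis .
    qed (use s in \<open>auto simp: nb_cheb_def field_simps power2_eq_square\<close>)
  qed (use s in \<open>auto simp: nb_cheb_def\<close>)
qed

lemma borel_measurable_nb_cheb [measurable]: "nb_cheb q r \<in> borel_measurable borel"
  unfolding nb_cheb_def[abs_def] by (cases "r < 2") simp_all

text \<open>The integral is the number of closed nonbacktracking walks divided by \<open>n\<close>
  and by a power of \<open>sqrt q\<close>, hence nonnegative. That power is at least 1 and is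
  dropped in the upper bound.\<close>

lemma integral_nb_cheb_spectral_measure:
  assumes E: "E \<in> reg_graphs n (Suc q)" and n: "n > 0" and q: "q > 0" and r: "r > 0"
  shows "0 \<le> integral\<^sup>L (spectral_measure q n E) (nb_cheb q r)"
    and "integral\<^sup>L (spectral_measure q n E) (nb_cheb q r)
      \<le> real r * real (Suc q) ^ r * (\<Sum>l = 3..r. real (card (cycles E l))) / real n"
proof -
  let ?s = "sqrt (real q) ^ r" and ?K = "\<Sum>x<n. real (card (nb_walks E r x x))"
  have s: "?s \<ge> 1" using q by (intro one_le_power) simp
  define S where "S = (\<Sum>x\<in>#adj_eigenvalues n E. nb_cheb q r (x / sqrt (real q)))"
  have "?s * S = ?K"
    unfolding S_def sum_mset_distrib_left
    using sum_nb_poly_adj_eigenvalues(2)[OF E, of r] by (simp add: nb_poly_eq_nb_cheb[OF q])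
  then have "?K / ?s = S" using s by (metis nonzero_mult_div_cancel_left not_one_le_zero)
  then have eq: "integral\<^sup>L (spectral_measure q n E) (nb_cheb q r) = ?K / ?s / real n"
    using spectral_measure_integral(3)[OF sum_nb_poly_adj_eigenvalues(1)[OF E] n, of "nb_cheb q r" q]
    unfolding S_def[symmetric] by simp
  show "0 \<le> integral\<^sup>L (spectral_measure q n E) (nb_cheb q r)"
    unfolding eq by (simp add: sum_nonneg)
  have "?K \<ge> 0" by (intro sum_nonneg) simp
  then have "?K / ?s \<le> ?K / 1" using s by (intro divide_left_mono) simp_all
  then have "?K / ?s \<le> ?K" by simp
  also have "\<dots> \<le> real r * real (Suc q) ^ r * (\<Sum>l = 3..r. real (card (cycles E l)))"
    using card_closed_nb_walks[OF E r] by (simp only: of_nat_sum[symmetric] of_nat_mult[symmetric] of_nat_power[symmetric] of_nat_le_iff)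
  finally show "integral\<^sup>L (spectral_measure q n E) (nb_cheb q r)
      \<le> real r * real (Suc q) ^ r * (\<Sum>l = 3..r. real (card (cycles E l))) / real n"
    unfolding eq by (rule divide_right_mono) simp
qed

lemma real_distribution_semicircle: "real_distribution semicircle"
  using prob_space_semicircle by (simp add: real_distribution_def real_distribution_axioms_def)

text \<open>The deterministic half: any sequence of graphs with few short cycles has spectral
  measures tending to the semicircle law along the index set \<open>S\<close>.\<close>

lemma wasserstein_spectral_measure_tendsto:
  fixes q :: "nat \<Rightarrow> nat" and E :: "nat \<Rightarrow> (nat \<times> nat) set"
  assumes q_pos: "\<And>n. q n > 0" and q_inf: "filterlim q at_top sequentially"
    and q_sub: "\<And>k c. c > 0 \<Longrightarrow> eventually (\<lambda>n. (2 * real (q n + 1)) ^ k \<le> real n powr c) sequentially"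
    and few: "\<And>l. l \<ge> 3 \<Longrightarrow> eventually (\<lambda>n. n \<in> S \<longrightarrow>
        E n \<in> reg_graphs n (q n + 1) \<and> (real (card (cycles (E n) l)))\<^sup>2 < real n powr (3 / 2)) sequentially"
    and p: "p \<ge> 1"
  shows "filterlim (\<lambda>n. wasserstein p (spectral_measure (q n) n (E n)) semicircle) (nhds 0)
    (sequentially \<sqinter> principal S)"
proof -
  define ok where "ok n \<longleftrightarrow> n \<in> S \<and> n > 0 \<and> E n \<in> reg_graphs n (Suc (q n))" for n
  \<comment> \<open>Filling the remaining indices with the limit law itself gives a full sequence of
    measures, to which the limit theorems apply.\<close>
  define \<mu> where "\<mu> n = (if ok n then spectral_measure (q n) n (E n) else semicircle)" for n
  have size: "size (adj_eigenvalues n (E n)) = n" if "ok n" for n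
    using sum_nb_poly_adj_eigenvalues(1)[of "E n" n "q n"] that by (simp add: ok_def)
  have dist: "real_distribution (\<mu> n)" for n
    using spectral_measure_integral(1)[OF size, of n "\<lambda>x. x"] real_distribution_semicircle
    by (auto simp: \<mu>_def ok_def)
  have int: "integrable (\<mu> n) f" if "continuous_on UNIV f" for n and f :: "real \<Rightarrow> real"
    using spectral_measure_integral(2)[OF size, of n f] integrable_semicircle[OF that]
      borel_measurable_continuous_onI[OF that] by (auto simp: \<mu>_def ok_def)
  have inv_q: "(\<lambda>n. 1 / real (q n)) \<longlonglongrightarrow> 0"
    by (intro tendsto_divide_0[OF tendsto_const] filterlim_at_top_imp_at_infinity
        filterlim_compose[OF filterlim_real_sequentially q_inf])
  have nb: "(\<lambda>n. integral\<^sup>L (\<mu> n) (nb_cheb (q n) r)) \<longlonglongrightarrow> 0" if r: "r > 0" for r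
  proof (rule Lim_null_comparison)
    have "eventually (\<lambda>n. \<forall>l\<in>{3..r}. n \<in> S \<longrightarrow>
        (real (card (cycles (E n) l)))\<^sup>2 < real n powr (3 / 2)) sequentially"
      by (rule eventually_ball_finite) (auto intro: eventually_mono[OF few])
    \<comment> \<open>On good indices \<open>d ^ r\<close> is at most \<open>n powr (1 / 8)\<close>
      and each cycle count at most \<open>n powr (3 / 4)\<close>; division by \<open>n\<close>
      leaves the exponent \<open>-1 / 8\<close>. The summand \<open>1 / q\<close> covers the filled
      indices.\<close>
    then show "eventually (\<lambda>n. norm (integral\<^sup>L (\<mu> n) (nb_cheb (q n) r))
        \<le> real r * real r * real n powr (- 1 / 8) + 1 / real (q n)) sequentially"
      using q_sub[of "1 / 8" r, simplified] eventually_gt_at_top[of 0]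
    proof eventually_elim
      case (elim n)
      show ?case
      proof (cases "ok n")
        case True
        then have E: "E n \<in> reg_graphs n (Suc (q n))" and S: "n \<in> S" by (auto simp: ok_def)
        have X: "real (card (cycles (E n) l)) \<le> real n powr (3 / 4)" if "l \<in> {3..r}" for l
        proof (rule power2_le_imp_le)
          have "(real n powr (3 / 4))\<^sup>2 = real n powr (3 / 2)"
            using elim(3) by (simp add: powr_powr flip: powr_realpow)
          then show "(real (card (cycles (E n) l)))\<^sup>2 \<le> (real n powr (3 / 4))\<^sup>2"
            using elim(1) that S by fastforce
        qed simp
        have "(\<Sum>l = 3..r. real (card (cycles (E n) l))) \<le> (\<Sum>l = 3..r. real n powr (3 / 4))"
          by (rule sum_mono) (rule X)
        also have "\<dots> \<le> real r * real n powr (3 / 4)" by (simp add: mult_right_mono)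
        finally have "real r * real (Suc (q n)) ^ r * (\<Sum>l = 3..r. real (card (cycles (E n) l))) / real n
            \<le> real r * real n powr (1 / 8) * (real r * real n powr (3 / 4)) / real n"
        proof (intro divide_right_mono mult_mono order_refl)
          have "real (Suc (q n)) ^ r \<le> (2 + 2 * real (q n)) ^ r" by (rule power_mono) auto
          then show "real (Suc (q n)) ^ r \<le> real n powr (1 / 8)" using elim(2) by linarith
        qed (auto intro!: sum_nonneg)
        also have "\<dots> = real r * real r * (real n powr (1 / 8) * real n powr (3 / 4) * real n powr (- 1))"
          using elim(3) by (simp add: powr_minus_divide)
        also have "real n powr (1 / 8) * real n powr (3 / 4) * real n powr (- 1) = real n powr (- 1 / 8)"
          unfolding powr_add[symmetric] by simp
        finally have up: "real r * real (Suc (q n)) ^ r * (\<Sum>l = 3..r. real (card (cycles (E n) l))) / real n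
            \<le> real r * real r * real n powr (- 1 / 8)" .
        have \<mu>: "\<mu> n = spectral_measure (q n) n (E n)" using True by (simp add: \<mu>_def)
        have "1 / real (q n) \<ge> 0" by simp
        then show ?thesis
          using up integral_nb_cheb_spectral_measure[OF E elim(3) q_pos r] unfolding \<mu> real_norm_def by linarith
      next
        \<comment> \<open>Against the semicircle law only the constant Chebyshev polynomial
          contributes, which enters \<open>nb_cheb\<close> at \<open>r = 2\<close> with weight
          \<open>1 / q\<close>.\<close>
        case False
        have "integral\<^sup>L semicircle (nb_cheb (q n) r) = integral\<^sup>L semicircle (cheb r)
            - (if r < 2 then 0 else integral\<^sup>L semicircle (cheb (r - 2)) / real (q n))"
          using integral_cheb_semicircle(1) by (auto simp: nb_cheb_def[abs_def])
        then have "norm (integral\<^sup>L semicircle (nb_cheb (q n) r)) \<le> 1 / real (q n)"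
          using r by (simp add: integral_cheb_semicircle(2))
        then show ?thesis using False by (simp add: \<mu>_def add_increasing)
      qed
    qed
    have "(\<lambda>n. real n powr (- 1 / 8)) \<longlonglongrightarrow> 0"
      by (rule tendsto_neg_powr) (auto intro: filterlim_real_sequentially)
    then have "(\<lambda>n. real r * real r * real n powr (- 1 / 8) + 1 / real (q n)) \<longlonglongrightarrow> real r * real r * 0 + 0"
      by (intro tendsto_intros inv_q)
    then show "(\<lambda>n. real r * real r * real n powr (- 1 / 8) + 1 / real (q n)) \<longlonglongrightarrow> 0" by simp
  qed
  have cheb: "(\<lambda>n. integral\<^sup>L (\<mu> n) (cheb r)) \<longlonglongrightarrow> integral\<^sup>L semicircle (cheb r)" for r
  proof (induction r rule: less_induct)
    case (less r)
    \<comment> \<open>The subtracted polynomial has degree \<open>r - 2\<close>; its integrals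
      converge by induction, so the factor \<open>1 / q\<close> sends that term to
      \<open>0\<close>.\<close>
    have split: "integral\<^sup>L (\<mu> n) (cheb r) = integral\<^sup>L (\<mu> n) (nb_cheb (q n) r)
        + (if r < 2 then 0 else integral\<^sup>L (\<mu> n) (cheb (r - 2)) * (1 / real (q n)))" for n
      using int[OF continuous_cheb, of n] by (auto simp: nb_cheb_def[abs_def])
    show ?case
    proof (cases "r = 0")
      case True
      have c0: "integral\<^sup>L (\<mu> n) (cheb 0) = 1" for n
        using prob_space.prob_space[OF real_distribution.axioms(1)[OF dist[of n]]] by (simp add: cheb.simps(1)[abs_def])
      show ?thesis unfolding True c0 integral_cheb_semicircle(2) by simp
    next
      case False
      have "(\<lambda>n. if r < 2 then 0 else integral\<^sup>L (\<mu> n) (cheb (r - 2)) * (1 / real (q n))) \<longlonglongrightarrow> 0"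
        using tendsto_mult[OF less[of "r - 2"] inv_q] False by (cases "r < 2") auto
      then show ?thesis
        unfolding split using tendsto_add[OF nb[of r]] False by (simp add: integral_cheb_semicircle(2))
    qed
  qed
  have mom: "(\<lambda>n. integral\<^sup>L (\<mu> n) (\<lambda>x. x ^ k)) \<longlonglongrightarrow> integral\<^sup>L semicircle (\<lambda>x. x ^ k)" for k
    by (rule moments_tendsto[OF int cheb])
  have pow: "integrable (\<mu> n) (\<lambda>x. x ^ k)" "integrable semicircle (\<lambda>x. x ^ k)" for n k
    by (intro int integrable_semicircle continuous_intros)+
  have "weak_conv_m \<mu> semicircle"
    by (rule weak_conv_if_moments_tendsto[OF dist real_distribution_semicircle pow mom semicircle_even_moment_le])
  then have W: "(\<lambda>n. wasserstein p (\<mu> n) semicircle) \<longlonglongrightarrow> 0"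
    by (rule wasserstein_tendsto_0[OF dist real_distribution_semicircle pow mom _ p])
  \<comment> \<open>Far out in \<open>S\<close> no index was filled, so the limit transfers to the
    spectral measures there.\<close>
  have "eventually (\<lambda>n. n \<in> S \<longrightarrow> ok n) sequentially"
    using few[of 3, simplified] eventually_gt_at_top[of 0] by eventually_elim (auto simp: ok_def)
  then have "eventually (\<lambda>n. wasserstein p (\<mu> n) semicircle
      = wasserstein p (spectral_measure (q n) n (E n)) semicircle) (sequentially \<sqinter> principal S)"
    unfolding eventually_inf_principal by eventually_elim (simp add: \<mu>_def)
  from filterlim_cong[OF refl refl this] show ?thesis
    using filterlim_mono[OF W order_refl inf_le1] by blast
qed

section \<open>Growth of the degree, second-moment bound and Borel-Cantelli\<close>

lemma subpolynomial_degree: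
  fixes q :: "nat \<Rightarrow> nat"
  assumes q_inf: "filterlim q at_top sequentially"
    and q_small: "(\<lambda>n. ln (real (q n)) / ln (real n)) \<longlonglongrightarrow> 0" and c: "c > 0"
  shows "eventually (\<lambda>n. (2 * real (q n + 1)) ^ k \<le> real n powr c) sequentially"
proof -
  \<comment> \<open>The exponent needed is \<open>3 * k\<close>; the \<open>+ 1\<close> avoids a
    zero denominator when \<open>k = 0\<close>.\<close>
  have "eventually (\<lambda>n. ln (real (q n)) / ln (real n) < c / real (3 * k + 1)) sequentially"
    using c by (intro order_tendstoD(2)[OF q_small]) simp
  moreover have "eventually (\<lambda>n. q n \<ge> 2) sequentially"
    using q_inf by (simp add: filterlim_at_top)
  ultimately show ?thesis
    using eventually_gt_at_top[of 1]
  proof eventually_elim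
    case (elim n)
    let ?q = "real (q n)"
    have q2: "?q \<ge> 2" using elim by simp
    have l: "ln (real n) > 0" "ln ?q > 0" using elim q2 by simp_all
    \<comment> \<open>A pure power of \<open>q\<close> is easier to compare with \<open>n\<close>
      through logarithms; exponent 3 suffices once \<open>q \<ge> 2\<close>.\<close>
    have "2 * real (q n + 1) \<le> ?q ^ 3"
    proof -
      have "2 * (?q + 1) \<le> 4 * ?q" using q2 by simp
      also have "\<dots> \<le> ?q\<^sup>2 * ?q" using q2 power_mono[of 2 ?q 2] by (intro mult_right_mono) auto
      finally show ?thesis by (simp add: power2_eq_square power3_eq_cube)
    qed
    then have "(2 * real (q n + 1)) ^ k \<le> (?q ^ 3) ^ k" by (rule power_mono) simp
    also have "\<dots> = exp (ln ?q) ^ (3 * k)" using q2 by (simp add: power_mult)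
    also have "\<dots> = exp (real (3 * k) * ln ?q)" by (rule exp_of_nat_mult[symmetric])
    also have "\<dots> \<le> exp (c * ln (real n))"
    proof -
      have "real (3 * k + 1) * ln ?q < c * ln (real n)" using elim(1) l by (simp add: field_simps)
      then show ?thesis using l by (simp add: algebra_simps)
    qed
    also have "\<dots> = real n powr c" using elim by (simp add: powr_def)
    finally show ?case .
  qed
qed

text \<open>Markov's inequality for the square of the number of cycles, at the threshold
  \<open>n powr (3 / 2)\<close>. Nonmembers of the graph class carry no mass.\<close>

lemma prob_many_cycles_le:
  assumes ne: "reg_graphs n d \<noteq> {}" and d: "d > 0" and n: "n \<ge> 4 * (d + 1) + 8 * l" and l: "l \<ge> 3"
  shows "measure (measure_pmf (pmf_of_set (reg_graphs n d)))
      {E. \<not> (E \<in> reg_graphs n d \<and> (real (card (cycles E l)))\<^sup>2 < real n powr (3 / 2))}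
    \<le> real (1 + l\<^sup>2) * (2 * real d) ^ (2 * l) * real n powr (- 3 / 2)"
proof -
  let ?R = "reg_graphs n d" and ?t = "real n powr (3 / 2)"
  let ?B = "{E \<in> ?R. ?t \<le> (real (card (cycles E l)))\<^sup>2}"
  have R: "finite ?R" "card ?R > 0" using finite_reg_graphs ne by (auto simp: card_gt_0_iff)
  have t: "?t > 0" using n by simp
  have "real (card ?B) * ?t \<le> (\<Sum>E\<in>?B. (real (card (cycles E l)))\<^sup>2)"
    using sum_bounded_below[of ?B ?t "\<lambda>E. (real (card (cycles E l)))\<^sup>2"] by simp
  also have "\<dots> \<le> (\<Sum>E\<in>?R. (real (card (cycles E l)))\<^sup>2)"
    using R by (intro sum_mono2) auto
  also have "\<dots> = real (\<Sum>E\<in>?R. (card (cycles E l))\<^sup>2)" by simp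
  also have "\<dots> \<le> real ((1 + l\<^sup>2) * (2 * d) ^ (2 * l) * card ?R)"
    unfolding of_nat_le_iff by (rule sum_card_cycles_square[OF d n l])
  finally have "real (card ?B) / real (card ?R) \<le> real (1 + l\<^sup>2) * (2 * real d) ^ (2 * l) / ?t"
    using R t by (simp add: field_simps)
  moreover have "?R \<inter> {E. \<not> (E \<in> ?R \<and> (real (card (cycles E l)))\<^sup>2 < ?t)} = ?B" by auto
  ultimately show ?thesis
    using R ne by (simp add: measure_pmf_of_set powr_minus_divide)
qed

text \<open>The powers of the degree are absorbed by \<open>n powr (1 / 4)\<close>, so the bad
  events have probabilities of order \<open>n powr (- 5 / 4)\<close>, which is summable.\<close>

lemma AE_few_cycles:
  fixes q :: "nat \<Rightarrow> nat" and G :: "nat \<Rightarrow> 'w \<Rightarrow> (nat \<times> nat) set"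
  assumes q_sub: "\<And>k c. c > 0 \<Longrightarrow> eventually (\<lambda>n. (2 * real (q n + 1)) ^ k \<le> real n powr c) sequentially"
    and prob: "prob_space M" and G [measurable]: "\<And>n. G n \<in> measurable M (count_space UNIV)"
    and unif: "\<And>n. reg_graphs n (q n + 1) \<noteq> {} \<Longrightarrow>
                 distr M (count_space UNIV) (G n) = measure_pmf (pmf_of_set (reg_graphs n (q n + 1)))"
    and l: "l \<ge> 3"
  shows "AE \<omega> in M. eventually (\<lambda>n. reg_graphs n (q n + 1) \<noteq> {} \<longrightarrow>
      G n \<omega> \<in> reg_graphs n (q n + 1) \<and> (real (card (cycles (G n \<omega>) l)))\<^sup>2 < real n powr (3 / 2)) sequentially"
proof -
  interpret prob_space M by fact
  define bad where "bad n = {E. \<not> (E \<in> reg_graphs n (q n + 1) \<and> (real (card (cycles E l)))\<^sup>2 < real n powr (3 / 2))}" for n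
  \<comment> \<open>Where the graph class is empty the law of \<open>G n\<close> is unspecified, and
    the claim is vacuous; the bad event is set to be empty.\<close>
  define A where "A n = (if reg_graphs n (q n + 1) = {} then {} else G n -` bad n \<inter> space M)" for n
  have A: "A n \<in> sets M" for n unfolding A_def using measurable_sets[OF G, of "bad n" n] by simp
  have "summable (\<lambda>n. measure M (A n))"
  proof (rule summable_comparison_test_ev)
    show "summable (\<lambda>n. real (1 + l\<^sup>2) * real n powr (- 5 / 4))"
      by (intro summable_mult) (simp add: summable_real_powr_iff)
    \<comment> \<open>With \<open>2 * (q n + 1)\<close> at most \<open>n powr (1 / 2)\<close>, the
      left side generously bounds \<open>4 * (d + 1) + 8 * l\<close> for \<open>d = q n + 1\<close>,
      the size required by the switching estimates.\<close>
    have "eventually (\<lambda>n. real n powr (1 / 2) * 9 + real (8 * l) \<le> real n) sequentially"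
      by real_asymp
    then show "eventually (\<lambda>n. norm (measure M (A n)) \<le> real (1 + l\<^sup>2) * real n powr (- 5 / 4)) sequentially"
      using q_sub[of "1 / 4" "2 * l", simplified] q_sub[of "1 / 2" 1, simplified] eventually_gt_at_top[of 0]
    proof eventually_elim
      case (elim n)
      show ?case
      proof (cases "reg_graphs n (q n + 1) = {}")
        case False
        have "measure M (A n) = measure (distr M (count_space UNIV) (G n)) (bad n)"
          using False by (simp add: A_def measure_distr)
        also have "\<dots> \<le> real (1 + l\<^sup>2) * (2 * real (q n + 1)) ^ (2 * l) * real n powr (- 3 / 2)"
          unfolding unif[OF False] bad_def
        proof (rule prob_many_cycles_le[OF False _ _ l])
          have "real (4 * (q n + 1 + 1) + 8 * l) \<le> real n" using elim by simp
          then show "4 * (q n + 1 + 1) + 8 * l \<le> n" unfolding of_nat_le_iff .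
        qed simp
        also have "\<dots> \<le> real (1 + l\<^sup>2) * real n powr (1 / 4) * real n powr (- 3 / 2)"
          using elim(2) by (intro mult_right_mono mult_left_mono) (auto simp: algebra_simps)
        also have "\<dots> = real (1 + l\<^sup>2) * real n powr (- 5 / 4)" by (simp add: mult.assoc flip: powr_add)
        finally show ?thesis by simp
      qed (simp add: A_def)
    qed
  qed
  then have "AE \<omega> in M. eventually (\<lambda>n. \<omega> \<in> space M - A n) sequentially"
    by (intro borel_cantelli_AE1 A) (simp_all add: emeasure_eq_measure)
  then show ?thesis
  proof eventually_elim
    case (elim \<omega>)
    then show ?case by eventually_elim (auto simp: A_def bad_def split: if_splits)
  qed
qed

theorem theorem4p1:
  fixes q :: "nat \<Rightarrow> nat"
    and M :: "'w measure"
    and G :: "nat \<Rightarrow> 'w \<Rightarrow> (nat \<times> nat) set"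
  assumes q_pos: "\<And>n. q n > 0"
    and q_inf: "filterlim q at_top sequentially"
    and q_small: "(\<lambda>n. ln (real (q n)) / ln (real n)) \<longlonglongrightarrow> 0"
    and prob: "prob_space M"
    and indep: "prob_space.indep_vars M (\<lambda>_. count_space UNIV) G UNIV"
    and unif: "\<And>n. reg_graphs n (q n + 1) \<noteq> {} \<Longrightarrow>
                 distr M (count_space UNIV) (G n) = measure_pmf (pmf_of_set (reg_graphs n (q n + 1)))"
  shows "AE \<omega> in M. \<forall>p::real. p \<ge> 1 \<longrightarrow>
           filterlim (\<lambda>n. wasserstein p (spectral_measure (q n) n (G n \<omega>)) semicircle) (nhds 0)
             (sequentially \<sqinter> principal {n. reg_graphs n (q n + 1) \<noteq> {}})"
proof -
  note q_sub = subpolynomial_degree[OF q_inf q_small]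
  have G: "G n \<in> measurable M (count_space UNIV)" for n
    using indep unfolding prob_space.indep_vars_def[OF prob] by simp
  \<comment> \<open>The exceptional null set is a union over the countably many cycle lengths, so
    one null set serves all real \<open>p\<close>.\<close>
  have "AE \<omega> in M. \<forall>l\<in>{3..}. eventually (\<lambda>n. reg_graphs n (q n + 1) \<noteq> {} \<longrightarrow>
      G n \<omega> \<in> reg_graphs n (q n + 1) \<and> (real (card (cycles (G n \<omega>) l)))\<^sup>2 < real n powr (3 / 2)) sequentially"
    by (rule AE_ball_countable'[rotated]) (use AE_few_cycles[OF q_sub prob G unif] in auto)
  then show ?thesis
  proof eventually_elim
    case (elim \<omega>)
    show ?case
    proof (intro allI impI)
      fix p :: real assume p: "p \<ge> 1"
      show "filterlim (\<lambda>n. wasserstein p (spectral_measure (q n) n (G n \<omega>)) semicircle) (nhds 0)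
             (sequentially \<sqinter> principal {n. reg_graphs n (q n + 1) \<noteq> {}})"
        by (rule wasserstein_spectral_measure_tendsto[OF q_pos q_inf q_sub _ p]) (use elim in auto)
    qed
  qed
qed

end
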